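(* Let $p$ be a prime number, let $l\geq 1$ be an integer, and let $n$ be a natural number with $\gcd(n,p)=1$. The monomial dynamical system $\psi_n: x\mapsto x^n$ on $S_{p^{-l}}(1)$ is ergodic with respect to the Haar measure on $S_{p^{-l}}(1)$ if and only if it is uniquely ergodic.
   Context: $\mathbb{Q}_p$ is the field of $p$-adic numbers with $p$-adic absolute value $|\cdot|_p$ normalized by $|p|_p=p^{-1}$, and $\mathbb{Z}_p$ is the ring of $p$-adic integers. The sphere is $S_{p^{-l}}(1)=\{x\in\mathbb{Q}_p: |x-1|_p=p^{-l}\}$. When $\gcd(n,p)=1$, the map $\psi_n(x)=x^n$ maps $S_{p^{-l}}(1)$ into itself. A continuous map $\psi$ of a compact metric space $X$ into itself is uniquely ergodic if there exists exactly one Borel probability measure on $X$ that is invariant under $\psi$. The Haar measure on $S_{p^{-l}}(1)$ means the restriction to $S_{p^{-l}}(1)$ of the (additive) Haar measure of $\mathbb{Z}_p$, normalized to be a probability measure on $S_{p^{-l}}(1)$; it is $\psi_n$-invariant. *)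

theory Defs
  imports "HOL-Probability.Probability" "HOL-Algebra.Ring" "HOL-Computational_Algebra.Primes"
begin

section \<open>The field of p-adic numbers as the completion of the rationals\<close>

definition rat_padic_abs :: "nat \<Rightarrow> rat \<Rightarrow> real" where
  "rat_padic_abs p x =
     (if x = 0 then 0
      else real p powi (int (multiplicity (int p) (snd (quotient_of x)))
                        - int (multiplicity (int p) (fst (quotient_of x)))))"

definition padic_Cauchy :: "nat \<Rightarrow> (nat \<Rightarrow> rat) set" where
  "padic_Cauchy p = {X. \<forall>e>0. \<exists>N. \<forall>i\<ge>N. \<forall>j\<ge>N. rat_padic_abs p (X i - X j) < e}"

definition padic_equiv :: "nat \<Rightarrow> ((nat \<Rightarrow> rat) \<times> (nat \<Rightarrow> rat)) set" where
  "padic_equiv p = {(X, Y). X \<in> padic_Cauchy p \<and> Y \<in> padic_Cauchy p \<and>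
                            (\<lambda>i. rat_padic_abs p (X i - Y i)) \<longlonglongrightarrow> 0}"

definition Qp :: "nat \<Rightarrow> (nat \<Rightarrow> rat) set ring" where
  "Qp p = \<lparr>carrier = padic_Cauchy p // padic_equiv p,
           mult = (\<lambda>A B. \<Union>X\<in>A. \<Union>Y\<in>B. padic_equiv p `` {\<lambda>i. X i * Y i}),
           one = padic_equiv p `` {\<lambda>i. 1},
           zero = padic_equiv p `` {\<lambda>i. 0},
           add = (\<lambda>A B. \<Union>X\<in>A. \<Union>Y\<in>B. padic_equiv p `` {\<lambda>i. X i + Y i})\<rparr>"

definition padic_abs :: "nat \<Rightarrow> (nat \<Rightarrow> rat) set \<Rightarrow> real" where
  "padic_abs p A = (THE r. \<forall>X\<in>A. (\<lambda>i. rat_padic_abs p (X i)) \<longlonglongrightarrow> r)"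

text \<open>The default value outside the carrier is needed because the locale \<^locale>\<open>Metric_space\<close>
  requires nonnegativity and symmetry on the whole type.\<close>

definition padic_dist :: "nat \<Rightarrow> (nat \<Rightarrow> rat) set \<Rightarrow> (nat \<Rightarrow> rat) set \<Rightarrow> real" where
  "padic_dist p x y =
     (if x \<in> carrier (Qp p) \<and> y \<in> carrier (Qp p) then padic_abs p (x \<ominus>\<^bsub>Qp p\<^esub> y) else 0)"

definition padic_topology :: "nat \<Rightarrow> (nat \<Rightarrow> rat) set topology" where
  "padic_topology p = Metric_space.mtopology (carrier (Qp p)) (padic_dist p)"

definition Zp :: "nat \<Rightarrow> (nat \<Rightarrow> rat) set set" where
  "Zp p = {x \<in> carrier (Qp p). padic_abs p x \<le> 1}"

definition padic_sphere :: "nat \<Rightarrow> (nat \<Rightarrow> rat) set \<Rightarrow> real \<Rightarrow> (nat \<Rightarrow> rat) set set" where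
  "padic_sphere p a r = {x \<in> carrier (Qp p). padic_abs p (x \<ominus>\<^bsub>Qp p\<^esub> a) = r}"

definition sphere_at_one :: "nat \<Rightarrow> nat \<Rightarrow> (nat \<Rightarrow> rat) set set" where
  "sphere_at_one p l = padic_sphere p \<one>\<^bsub>Qp p\<^esub> (real p powi (- int l))"

definition monomial_map :: "nat \<Rightarrow> nat \<Rightarrow> (nat \<Rightarrow> rat) set \<Rightarrow> (nat \<Rightarrow> rat) set" where
  "monomial_map p n x = x [^]\<^bsub>Qp p\<^esub> n"

section \<open>Invariant measures, ergodicity and unique ergodicity\<close>

definition borel_of :: "'a topology \<Rightarrow> 'a measure" where
  "borel_of X = sigma (topspace X) {U. openin X U}"

definition invariant_prob :: "'a measure \<Rightarrow> ('a \<Rightarrow> 'a) \<Rightarrow> bool" where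
  "invariant_prob M f \<longleftrightarrow> prob_space M \<and> f \<in> measurable M M \<and> distr M M f = M"

definition ergodic :: "'a measure \<Rightarrow> ('a \<Rightarrow> 'a) \<Rightarrow> bool" where
  "ergodic M f \<longleftrightarrow> invariant_prob M f \<and>
     (\<forall>A\<in>sets M. f -` A \<inter> space M = A \<longrightarrow> measure M A = 0 \<or> measure M A = 1)"

text \<open>The notion is meant for a continuous self-map \<open>f\<close> of a compact metrizable space \<open>X\<close>;
  these standing assumptions are not repeated in the definition.\<close>

definition uniquely_ergodic :: "'a topology \<Rightarrow> ('a \<Rightarrow> 'a) \<Rightarrow> bool" where
  "uniquely_ergodic X f \<longleftrightarrow> (\<exists>!M. sets M = sets (borel_of X) \<and> invariant_prob M f)"

section \<open>Haar measure\<close>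

definition is_Haar_Zp :: "nat \<Rightarrow> (nat \<Rightarrow> rat) set measure \<Rightarrow> bool" where
  "is_Haar_Zp p M \<longleftrightarrow>
     sets M = sets (borel_of (subtopology (padic_topology p) (Zp p))) \<and>
     (\<forall>a\<in>Zp p. \<forall>A\<in>sets M. emeasure M ((\<lambda>x. a \<oplus>\<^bsub>Qp p\<^esub> x) ` A) = emeasure M A) \<and>
     emeasure M (Zp p) = 1"

definition Haar_Zp :: "nat \<Rightarrow> (nat \<Rightarrow> rat) set measure" where
  "Haar_Zp p = (THE M. is_Haar_Zp p M)"

text \<open>Restriction to \<open>S\<close>, normalized to total mass 1; meant for \<open>S \<subseteq> Zp p\<close> of positive Haar measure.\<close>

definition Haar_restricted :: "nat \<Rightarrow> (nat \<Rightarrow> rat) set set \<Rightarrow> (nat \<Rightarrow> rat) set measure" where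
  "Haar_restricted p S =
     scale_measure (inverse (emeasure (Haar_Zp p) S)) (restrict_space (Haar_Zp p) S)"

end

theory Submission
  imports Defs "HOL-Number_Theory.Cong"
begin

text \<open>
  Both implications hold for a reason that has little to do with powers: on the sphere,
  \<open>x \<mapsto> x^n\<close> is an isometry, and an isometry of a compact ultrametric space permutes the
  finitely many balls of each fixed radius. Indeed \<open>x^n - y^n\<close> is \<open>x - y\<close> times a sum of \<open>n\<close>
  products of elements congruent to 1 modulo \<open>p\<close>; the sum is congruent to \<open>n\<close>, hence a unit
  (\<open>v_power_diff\<close>, \<open>monomial_map_isometry\<close>).

  Normalized Haar measure on the sphere gives all balls of equal radius the same mass; call
  such a probability measure homogeneous. As the balls of a fixed radius partition the space,
  homogeneity determines their mass, and balls generate the Borel sets, so there is at most one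
  homogeneous measure (\<open>homogeneous_unique\<close>). Its image under an isometry is again homogeneous,
  so it is invariant (\<open>homogeneous_invariant\<close>).

  Suppose the homogeneous measure is ergodic. For a fixed radius, the points whose orbit
  eventually runs through the same balls as a given orbit form an invariant set that is a union
  of balls, so it has full measure and is everything: the isometry permutes the balls
  transitively (\<open>ergodic_orbits_meet\<close>). Every invariant probability measure is then
  homogeneous, hence equal to the given one. Conversely, if the invariant measure is unique
  and \<open>A\<close> is an invariant set of positive measure, then conditioning on \<open>A\<close> yields an invariant
  measure, which must be the original one; so \<open>A\<close> has measure 1
  (\<open>uniquely_ergodic_imp_ergodic\<close>).

  It remains to connect this with the concrete objects. Translation-invariant probability
  measures on the \<open>p\<close>-adic integers are exactly the homogeneous ones
  (\<open>is_Haar_iff_homogeneous\<close>), which gives uniqueness of Haar measure; existence comes from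
  random \<open>p\<close>-adic expansions with independent, uniformly distributed digits
  (\<open>homogeneous_digit_value\<close>). A sphere is a union of sufficiently small balls, so the
  restriction of Haar measure to it is homogeneous too (\<open>homogeneous_Haar_restricted\<close>).
\<close>

section \<open>Isometries of a tree of balls\<close>

text \<open>The only trace of the metric that the argument uses is its tree of balls: \<open>R k\<close> stands for
  being at distance at most the \<open>k\<close>-th of a decreasing sequence of radii. Finiteness of each
  level stands in for compactness.\<close>

locale ball_tree =
  fixes X :: "'a topology" and R :: "nat \<Rightarrow> 'a \<Rightarrow> 'a \<Rightarrow> bool"
  assumes R_refl: "x \<in> topspace X \<Longrightarrow> R k x x"
    and R_sym: "\<lbrakk>x \<in> topspace X; y \<in> topspace X; R k x y\<rbrakk> \<Longrightarrow> R k y x"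
    and R_trans: "\<lbrakk>x \<in> topspace X; y \<in> topspace X; z \<in> topspace X; R k x y; R k y z\<rbrakk> \<Longrightarrow> R k x z"
    and R_Suc: "\<lbrakk>x \<in> topspace X; y \<in> topspace X; R (Suc k) x y\<rbrakk> \<Longrightarrow> R k x y"
    and finite_level: "finite ((\<lambda>x. {y \<in> topspace X. R k x y}) ` topspace X)"
    and openin_iff: "openin X U \<longleftrightarrow>
      U \<subseteq> topspace X \<and> (\<forall>x\<in>U. \<exists>k. {y \<in> topspace X. R k x y} \<subseteq> U)"
begin

definition cell :: "nat \<Rightarrow> 'a \<Rightarrow> 'a set" where
  "cell k x = {y \<in> topspace X. R k x y}"

definition cells :: "'a set set" where
  "cells = (\<Union>k. cell k ` topspace X)"

lemma cell_subset: "cell k x \<subseteq> topspace X"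
  by (auto simp: cell_def)

lemma cell_self: "x \<in> topspace X \<Longrightarrow> x \<in> cell k x"
  by (simp add: cell_def R_refl)

lemma cell_eq: "\<lbrakk>x \<in> topspace X; y \<in> cell k x\<rbrakk> \<Longrightarrow> cell k y = cell k x"
  using R_sym R_trans unfolding cell_def by blast

lemma cell_eq_iff: "\<lbrakk>x \<in> topspace X; y \<in> topspace X\<rbrakk> \<Longrightarrow> cell k x = cell k y \<longleftrightarrow> R k x y"
  using cell_eq[of x y k] cell_self[of y k] by (auto simp: cell_def)

lemma R_mono: "\<lbrakk>j \<le> k; x \<in> topspace X; y \<in> topspace X; R k x y\<rbrakk> \<Longrightarrow> R j x y"
  by (induction rule: dec_induct) (auto intro: R_Suc)

lemma finite_cell_image: "finite (cell k ` topspace X)"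
  using finite_level[of k] by (simp add: cell_def[abs_def])

lemma countable_cells: "countable cells"
  unfolding cells_def using finite_cell_image by (auto intro: countable_finite)

text \<open>Two balls are nested or disjoint, so the balls with the empty set form a generator of the
  Borel sets that is closed under intersection, as the uniqueness theorem for measures requires.\<close>

lemma Int_stable_cells: "Int_stable (insert {} cells)"
proof -
  have nested: "cell j x \<inter> cell k y \<in> insert {} cells"
    if "j \<le> k" "x \<in> topspace X" "y \<in> topspace X" for j k x y
  proof (cases "cell j x \<inter> cell k y = {}")
    case False
    then obtain z where z: "z \<in> cell j x" "z \<in> cell k y" by blast
    then have zX: "z \<in> topspace X" by (simp add: cell_def)
    have "cell k z \<subseteq> cell j z"
      using R_mono[OF that(1) zX] by (auto simp: cell_def)
    then have "cell j x \<inter> cell k y = cell k z"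
      using z that cell_eq by blast
    then show ?thesis using zX by (auto simp: cells_def)
  qed simp
  show ?thesis
  proof (rule Int_stableI)
    fix A B assume A: "A \<in> insert {} cells" and B: "B \<in> insert {} cells"
    show "A \<inter> B \<in> insert {} cells"
    proof (cases "A = {} \<or> B = {}")
      case False
      then obtain j x k y where *: "A = cell j x" "x \<in> topspace X" "B = cell k y" "y \<in> topspace X"
        using A B by (auto simp: cells_def)
      show ?thesis
        using nested[of j k x y] nested[of k j y x] * by (metis Int_commute nat_le_linear)
    qed auto
  qed
qed

lemma openin_cell: "x \<in> topspace X \<Longrightarrow> openin X (cell k x)"
  using cell_eq[of x] by (subst openin_iff) (auto simp: cell_def)

lemma sets_borel_of: "sets (borel_of X) = sigma_sets (topspace X) {U. openin X U}"
  unfolding borel_of_def by (intro sets_measure_of) (auto dest: openin_subset)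

lemma space_borel_of: "space (borel_of X) = topspace X"
  unfolding borel_of_def by (intro space_measure_of) (auto dest: openin_subset)

lemma sets_borel_cells: "sets (borel_of X) = sigma_sets (topspace X) (insert {} cells)"
  unfolding sets_borel_of
proof (rule sigma_sets_eqI)
  fix U assume "U \<in> {U. openin X U}"
  then have U: "openin X U" by simp
  have "U = \<Union>{C \<in> cells. C \<subseteq> U}"
  proof
    show "U \<subseteq> \<Union>{C \<in> cells. C \<subseteq> U}"
    proof
      fix x assume x: "x \<in> U"
      then have xX: "x \<in> topspace X" using openin_subset[OF U] by blast
      obtain k where "cell k x \<subseteq> U" using x U openin_iff unfolding cell_def by blast
      then show "x \<in> \<Union>{C \<in> cells. C \<subseteq> U}"
        using cell_self[OF xX] xX by (auto simp: cells_def)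
    qed
  qed blast
  also have "\<dots> \<in> sigma_sets (topspace X) (insert {} cells)"
    by (rule sigma_sets_UNION)
       (auto intro: countable_subset[OF _ countable_cells] sigma_sets.Basic)
  finally show "U \<in> sigma_sets (topspace X) (insert {} cells)" .
next
  fix C assume "C \<in> insert {} cells"
  then show "C \<in> sigma_sets (topspace X) {U. openin X U}"
    using openin_cell by (auto simp: cells_def intro: sigma_sets.Basic)
qed

lemma cell_sets: "x \<in> topspace X \<Longrightarrow> cell k x \<in> sets (borel_of X)"
  unfolding sets_borel_of by (auto intro: sigma_sets.Basic openin_cell)

lemma measure_eqI_cells:
  assumes "prob_space M" "prob_space N"
    and M: "sets M = sets (borel_of X)" and N: "sets N = sets (borel_of X)"
    and eq: "\<And>k x. x \<in> topspace X \<Longrightarrow> emeasure M (cell k x) = emeasure N (cell k x)"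
  shows "M = N"
proof (rule measure_eqI_generator_eq_countable[OF Int_stable_cells, where \<Omega> = "topspace X"
      and A = "cell 0 ` topspace X"])
  interpret M: prob_space M by fact
  show "insert {} cells \<subseteq> Pow (topspace X)" using cell_subset by (auto simp: cells_def)
  show "\<And>C. C \<in> insert {} cells \<Longrightarrow> emeasure M C = emeasure N C"
    using eq by (auto simp: cells_def)
  show "sets M = sigma_sets (topspace X) (insert {} cells)"
       "sets N = sigma_sets (topspace X) (insert {} cells)"
    using M N sets_borel_cells by simp_all
  show "cell 0 ` topspace X \<subseteq> insert {} cells" by (auto simp: cells_def)
  show "\<Union> (cell 0 ` topspace X) = topspace X" using cell_self cell_subset by blast
  show "countable (cell 0 ` topspace X)" by (intro countable_finite finite_cell_image)
qed (use assms(1) in \<open>simp add: finite_measure.emeasure_finite prob_space_def\<close>)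

definition homogeneous :: "'a measure \<Rightarrow> bool" where
  "homogeneous M \<longleftrightarrow> prob_space M \<and> sets M = sets (borel_of X) \<and>
     (\<forall>k. \<forall>x\<in>topspace X. \<forall>y\<in>topspace X. measure M (cell k x) = measure M (cell k y))"

text \<open>The cells of level \<open>k\<close> partition the space, so their common mass is forced to be the
  reciprocal of their number.\<close>

lemma homogeneous_cell:
  assumes "homogeneous M" "x \<in> topspace X"
  shows "measure M (cell k x) * card (cell k ` topspace X) = 1"
proof -
  interpret prob_space M using assms(1) by (simp add: homogeneous_def)
  have sM: "sets M = sets (borel_of X)" using assms(1) by (simp add: homogeneous_def)
  have sp: "space M = topspace X" using sets_eq_imp_space_eq[OF sM] space_borel_of by simp
  have "1 = measure M (\<Union>C\<in>cell k ` topspace X. C)"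
  proof -
    have "(\<Union>C\<in>cell k ` topspace X. C) = space M"
      using cell_self[of _ k] cell_subset[of k] sp by auto
    then show ?thesis using prob_space by (simp only:)
  qed
  also have "\<dots> = (\<Sum>C\<in>cell k ` topspace X. measure M C)"
  proof (rule finite_measure_finite_Union[OF finite_cell_image])
    show "disjoint_family_on (\<lambda>C. C) (cell k ` topspace X)"
      unfolding disjoint_family_on_def using cell_eq by blast
  qed (use cell_sets sM in auto)
  also have "\<dots> = (\<Sum>C\<in>cell k ` topspace X. measure M (cell k x))"
    by (rule sum.cong[OF refl]) (use assms homogeneous_def in blast)
  finally show ?thesis by (simp add: mult.commute)
qed

lemma homogeneous_cell_pos:
  assumes "homogeneous M" "x \<in> topspace X"
  shows "measure M (cell k x) > 0"
  using homogeneous_cell[OF assms, of k]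
  by (metis measure_nonneg less_eq_real_def mult_zero_left zero_neq_one)

lemma homogeneous_unique:
  assumes M: "homogeneous M" and N: "homogeneous N"
  shows "M = N"
proof (rule measure_eqI_cells)
  interpret M: prob_space M using M by (simp add: homogeneous_def)
  interpret N: prob_space N using N by (simp add: homogeneous_def)
  fix k x assume x: "x \<in> topspace X"
  have "measure M (cell k x) = measure N (cell k x)"
    using homogeneous_cell[OF M x, of k] homogeneous_cell[OF N x, of k]
    by (metis mult_cancel_right mult_zero_right zero_neq_one)
  then show "emeasure M (cell k x) = emeasure N (cell k x)"
    by (simp add: M.emeasure_eq_measure N.emeasure_eq_measure)
qed (use M N in \<open>auto simp: homogeneous_def\<close>)

definition level_isometry :: "('a \<Rightarrow> 'a) \<Rightarrow> bool" where
  "level_isometry f \<longleftrightarrow> f \<in> topspace X \<rightarrow> topspace X \<and>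
     (\<forall>k. \<forall>x\<in>topspace X. \<forall>y\<in>topspace X. R k (f x) (f y) \<longleftrightarrow> R k x y)"

lemma vimage_cell_image:
  assumes "level_isometry f" "x \<in> topspace X"
  shows "f -` cell k (f x) \<inter> topspace X = cell k x"
  using assms by (auto simp: level_isometry_def cell_def)

text \<open>An isometry induces an injective self-map of the finite set of cells of each level; by
  counting, this map is surjective.\<close>

lemma level_isometry_dense:
  assumes f: "level_isometry f" and y: "y \<in> topspace X"
  shows "\<exists>x\<in>topspace X. cell k (f x) = cell k y"
proof -
  let ?Q = "cell k ` topspace X"
  \<comment> \<open>The choice of a point in a cell is harmless: \<open>f\<close> sends points of one cell into one cell.\<close>
  define g where "g C = cell k (f (SOME x. x \<in> topspace X \<and> cell k x = C))" for C
  have g: "g (cell k x) = cell k (f x)" if x: "x \<in> topspace X" for x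
  proof -
    let ?x = "SOME x'. x' \<in> topspace X \<and> cell k x' = cell k x"
    have "?x \<in> topspace X \<and> cell k ?x = cell k x" by (rule someI) (use x in simp)
    then have "R k (f ?x) (f x)" "f ?x \<in> topspace X" "f x \<in> topspace X"
      using f x cell_eq_iff by (auto simp: level_isometry_def)
    then show ?thesis unfolding g_def by (subst cell_eq_iff)
  qed
  have "inj_on g ?Q"
  proof (rule inj_onI)
    fix C D assume "C \<in> ?Q" "D \<in> ?Q" and gg: "g C = g D"
    then obtain x z where *: "x \<in> topspace X" "z \<in> topspace X" "C = cell k x" "D = cell k z"
      by blast
    then have fx: "f x \<in> topspace X" "f z \<in> topspace X" using f by (auto simp: level_isometry_def)
    have "R k (f x) (f z)" using gg g * cell_eq_iff[OF fx] by simp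
    then have "R k x z" using f * by (auto simp: level_isometry_def)
    then show "C = D" using * cell_eq_iff by blast
  qed
  moreover have "g ` ?Q \<subseteq> ?Q" using g f by (auto simp: level_isometry_def)
  ultimately have "g ` ?Q = ?Q" by (intro endo_inj_surj finite_cell_image)
  then have "cell k y \<in> g ` ?Q" using y by blast
  then obtain x where "x \<in> topspace X" "cell k y = g (cell k x)" by blast
  then show ?thesis using g by (intro bexI[of _ x]) simp_all
qed

lemma level_isometry_vimage_cell:
  assumes f: "level_isometry f" and y: "y \<in> topspace X"
  shows "\<exists>x\<in>topspace X. f -` cell k y \<inter> topspace X = cell k x"
  using level_isometry_dense[OF assms, of k] vimage_cell_image[OF f] by metis

lemma level_isometry_measurable:
  assumes f: "level_isometry f" and M: "sets M = sets (borel_of X)"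
  shows "f \<in> measurable M M"
proof (rule measurable_sigma_sets[where \<Omega> = "topspace X" and A = "insert {} cells"])
  have sp: "space M = topspace X" using sets_eq_imp_space_eq[OF M] space_borel_of by simp
  show "sets M = sigma_sets (topspace X) (insert {} cells)" using M sets_borel_cells by simp
  show "insert {} cells \<subseteq> Pow (topspace X)" using cell_subset by (auto simp: cells_def)
  show "f \<in> space M \<rightarrow> topspace X" using f sp by (simp add: level_isometry_def)
  fix C assume "C \<in> insert {} cells"
  then show "f -` C \<inter> space M \<in> sets M"
    using level_isometry_vimage_cell[OF f] cell_sets M sp by (auto simp: cells_def) metis
qed

text \<open>The preimage of a cell is a cell of the same level, so the image measure is homogeneous and
  uniqueness applies.\<close>

lemma homogeneous_invariant:
  assumes f: "level_isometry f" and M: "homogeneous M"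
  shows "invariant_prob M f"
proof -
  interpret prob_space M using M by (simp add: homogeneous_def)
  have sM: "sets M = sets (borel_of X)" using M by (simp add: homogeneous_def)
  have sp: "space M = topspace X" using sets_eq_imp_space_eq[OF sM] space_borel_of by simp
  have meas: "f \<in> measurable M M" by (rule level_isometry_measurable[OF f sM])
  have distr_cell: "\<exists>z\<in>topspace X. measure (distr M M f) (cell k x) = measure M (cell k z)"
    if "x \<in> topspace X" for k x
    using level_isometry_vimage_cell[OF f that, of k] meas cell_sets[OF that] sM sp
    by (simp add: measure_distr) metis
  have "homogeneous (distr M M f)"
    unfolding homogeneous_def
  proof (intro conjI allI ballI)
    show "prob_space (distr M M f)" by (rule prob_space_distr[OF meas])
    show "sets (distr M M f) = sets (borel_of X)" by (simp add: sM)
    fix k x y assume "x \<in> topspace X" "y \<in> topspace X"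
    then show "measure (distr M M f) (cell k x) = measure (distr M M f) (cell k y)"
      using distr_cell[of x k] distr_cell[of y k] M unfolding homogeneous_def by metis
  qed
  then have "distr M M f = M" using homogeneous_unique M by blast
  then show ?thesis using meas prob_space_axioms by (simp add: invariant_prob_def)
qed

lemma level_isometry_funpow:
  assumes "level_isometry f"
  shows "level_isometry (f ^^ i)"
  using assms by (induction i) (auto simp: level_isometry_def Pi_iff)

text \<open>The preimage of the cell around \<open>f x\<close> is exactly the cell around \<open>x\<close>, so an invariant
  measure is constant along the orbit of a cell.\<close>

lemma invariant_measure_cell:
  assumes f: "level_isometry f" and N: "sets N = sets (borel_of X)" "invariant_prob N f"
    and x: "x \<in> topspace X"
  shows "measure N (cell k ((f ^^ i) x)) = measure N (cell k x)"
proof (induction i)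
  case (Suc i)
  let ?y = "(f ^^ i) x"
  have sp: "space N = topspace X" using sets_eq_imp_space_eq[OF N(1)] space_borel_of by simp
  have y: "?y \<in> topspace X"
    using level_isometry_funpow[OF f] x by (auto simp: level_isometry_def)
  then have fy: "f ?y \<in> topspace X" using f by (auto simp: level_isometry_def)
  have "measure N (cell k (f ?y)) = measure (distr N N f) (cell k (f ?y))"
    using N by (simp add: invariant_prob_def)
  also have "\<dots> = measure N (f -` cell k (f ?y) \<inter> space N)"
    using N cell_sets[OF fy] by (intro measure_distr) (auto simp: invariant_prob_def)
  also have "\<dots> = measure N (cell k ?y)"
    using vimage_cell_image[OF f y] sp by simp
  finally show ?case using Suc by simp
qed simp

text \<open>Transitivity on cells. Letting both points move forward, instead of asking that the orbit of
  \<open>x\<close> reach the cell of \<open>y\<close>, makes the set \<open>A\<close> of the proof strictly invariant without any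
  appeal to recurrence.\<close>

lemma ergodic_orbits_meet:
  assumes f: "level_isometry f" and M: "homogeneous M" and erg: "ergodic M f"
    and x: "x \<in> topspace X" and y: "y \<in> topspace X"
  shows "\<exists>i j. cell k ((f ^^ i) x) = cell k ((f ^^ j) y)"
proof (rule ccontr)
  assume neg: "\<not> ?thesis"
  interpret prob_space M using M by (simp add: homogeneous_def)
  have sM: "sets M = sets (borel_of X)" using M by (simp add: homogeneous_def)
  have sp: "space M = topspace X" using sets_eq_imp_space_eq[OF sM] space_borel_of by simp
  have fX: "(f ^^ i) z \<in> topspace X" if "z \<in> topspace X" for i z
    using level_isometry_funpow[OF f] that by (auto simp: level_isometry_def)
  have f1: "f z \<in> topspace X" if "z \<in> topspace X" for z
    using f that by (auto simp: level_isometry_def)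
  define A where "A = {z \<in> topspace X. \<exists>i j. R k ((f ^^ i) x) ((f ^^ j) z)}"
  have sat: "cell k z \<subseteq> A" if zA: "z \<in> A" for z
  proof
    fix w assume w: "w \<in> cell k z"
    obtain i j where ij: "R k ((f ^^ i) x) ((f ^^ j) z)" and z: "z \<in> topspace X"
      using zA unfolding A_def by blast
    have "R k ((f ^^ j) z) ((f ^^ j) w)"
      using w z level_isometry_funpow[OF f, of j] by (auto simp: level_isometry_def cell_def)
    then have "R k ((f ^^ i) x) ((f ^^ j) w)"
      using R_trans[OF _ _ _ ij] fX x z w by (auto simp: cell_def)
    then show "w \<in> A" using w by (auto simp: A_def cell_def)
  qed
  have "A \<subseteq> topspace X" by (auto simp: A_def)
  then have sub: "cell k ` A \<subseteq> cell k ` topspace X" by blast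
  have "A = \<Union>(cell k ` A)" using sat cell_self \<open>A \<subseteq> topspace X\<close> by blast
  moreover have "\<Union>(cell k ` A) \<in> sets M"
    using finite_subset[OF sub finite_cell_image] sub cell_sets sM
    by (intro sets.finite_Union) auto
  ultimately have As: "A \<in> sets M" by simp
  have "f -` A \<inter> space M = A"
  proof (rule subset_antisym; rule subsetI)
    fix z assume "z \<in> f -` A \<inter> space M"
    then obtain i j where "R k ((f ^^ i) x) ((f ^^ j) (f z))" and z: "z \<in> topspace X"
      by (auto simp: A_def sp)
    then have "R k ((f ^^ i) x) ((f ^^ Suc j) z)" by (simp add: funpow_swap1)
    then show "z \<in> A" using z unfolding A_def by blast
  next
    fix z assume "z \<in> A"
    then obtain i j where ij: "R k ((f ^^ i) x) ((f ^^ j) z)" and z: "z \<in> topspace X"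
      by (auto simp: A_def)
    then have "R k (f ((f ^^ i) x)) (f ((f ^^ j) z))"
      using f fX x by (auto simp: level_isometry_def)
    then have "R k ((f ^^ Suc i) x) ((f ^^ j) (f z))" by (simp add: funpow_swap1)
    then show "z \<in> f -` A \<inter> space M" using z f1 sp unfolding A_def by blast
  qed
  then have "measure M A = 0 \<or> measure M A = 1" using erg As by (auto simp: ergodic_def)
  moreover have "measure M A > 0"
  proof -
    have "x \<in> A" using x R_refl[OF x, of k] unfolding A_def by (auto intro!: exI[of _ 0])
    then have "measure M (cell k x) \<le> measure M A"
      using sat As by (intro finite_measure_mono) auto
    then show ?thesis using homogeneous_cell_pos[OF M x, of k] by linarith
  qed
  moreover have "measure M A < 1"
  proof -
    have yA: "y \<notin> A"
      using neg cell_eq_iff[OF fX[OF x] fX[OF y]] unfolding A_def by blast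
    have "cell k y \<inter> A = {}"
    proof (rule ccontr)
      assume "cell k y \<inter> A \<noteq> {}"
      then obtain z where z: "z \<in> cell k y" "z \<in> A" by blast
      then have "y \<in> cell k z" using cell_eq[OF y z(1)] cell_self[OF y] by simp
      then show False using sat[OF z(2)] yA by blast
    qed
    then have "measure M (cell k y \<union> A) = measure M (cell k y) + measure M A"
      using As cell_sets[OF y] sM by (intro finite_measure_Union) auto
    moreover have "measure M (cell k y \<union> A) \<le> 1" by simp
    ultimately show ?thesis using homogeneous_cell_pos[OF M y, of k] by linarith
  qed
  ultimately show False by linarith
qed

text \<open>By transitivity on cells, every invariant probability measure is homogeneous.\<close>

lemma ergodic_imp_uniquely_ergodic:
  assumes f: "level_isometry f" and M: "homogeneous M" and erg: "ergodic M f"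
  shows "uniquely_ergodic X f"
  unfolding uniquely_ergodic_def
proof (rule ex1I[of _ M])
  show "sets M = sets (borel_of X) \<and> invariant_prob M f"
    using M homogeneous_invariant[OF f M] by (simp add: homogeneous_def)
  fix N assume N: "sets N = sets (borel_of X) \<and> invariant_prob N f"
  have "homogeneous N"
    unfolding homogeneous_def
  proof (intro conjI allI ballI)
    fix k x y assume xy: "x \<in> topspace X" "y \<in> topspace X"
    obtain i j where "cell k ((f ^^ i) x) = cell k ((f ^^ j) y)"
      using ergodic_orbits_meet[OF f M erg xy] by blast
    then show "measure N (cell k x) = measure N (cell k y)"
      using invariant_measure_cell[OF f, of N] N xy by metis
  qed (use N in \<open>auto simp: invariant_prob_def\<close>)
  then show "N = M" using homogeneous_unique M by blast
qed

end

lemma invariant_prob_uniform_measure: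
  assumes M: "invariant_prob M f" and A: "A \<in> sets M" "f -` A \<inter> space M = A" "measure M A \<noteq> 0"
  shows "invariant_prob (uniform_measure M A) f"
proof -
  interpret prob_space M using M by (simp add: invariant_prob_def)
  have meas: "f \<in> measurable M M" and inv: "distr M M f = M"
    using M by (auto simp: invariant_prob_def)
  have meas': "f \<in> measurable (uniform_measure M A) (uniform_measure M A)"
    using meas by (simp add: measurable_def)
  have "distr (uniform_measure M A) (uniform_measure M A) f = uniform_measure M A"
  proof (rule measure_eqI)
    fix B assume "B \<in> sets (distr (uniform_measure M A) (uniform_measure M A) f)"
    then have B: "B \<in> sets M" by simp
    have "emeasure (distr (uniform_measure M A) (uniform_measure M A) f) B
        = emeasure (uniform_measure M A) (f -` B \<inter> space M)"
      using B meas' by (subst emeasure_distr) auto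
    also have "\<dots> = emeasure M (A \<inter> (f -` B \<inter> space M)) / emeasure M A"
      using A B meas by (intro emeasure_uniform_measure) auto
    also have "A \<inter> (f -` B \<inter> space M) = f -` (A \<inter> B) \<inter> space M"
      using A(2) by blast
    also have "emeasure M (f -` (A \<inter> B) \<inter> space M) = emeasure (distr M M f) (A \<inter> B)"
      using A B meas by (subst emeasure_distr) auto
    also have "\<dots> / emeasure M A = emeasure (uniform_measure M A) B"
      using A B inv by simp
    finally show "emeasure (distr (uniform_measure M A) (uniform_measure M A) f) B
        = emeasure (uniform_measure M A) B" .
  qed simp
  moreover have "prob_space (uniform_measure M A)"
    using A by (intro prob_space_uniform_measure) (auto simp: emeasure_eq_measure)
  ultimately show ?thesis using meas' by (simp add: invariant_prob_def)
qed

text \<open>If \<open>A\<close> is invariant with positive measure, the measure conditioned on \<open>A\<close> is invariant as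
  well, so it is the given one; but it gives \<open>A\<close> mass 1.\<close>

lemma uniquely_ergodic_imp_ergodic:
  assumes ue: "uniquely_ergodic X f" and M: "sets M = sets (borel_of X)" "invariant_prob M f"
  shows "ergodic M f"
  unfolding ergodic_def
proof (intro conjI ballI impI M)
  interpret prob_space M using M by (simp add: invariant_prob_def)
  fix A assume A: "A \<in> sets M" "f -` A \<inter> space M = A"
  show "measure M A = 0 \<or> measure M A = 1"
  proof (cases "measure M A = 0")
    case False
    have "sets (uniform_measure M A) = sets (borel_of X)" using M by simp
    then have "uniform_measure M A = M"
      using ue M invariant_prob_uniform_measure[OF M(2) A False]
      unfolding uniquely_ergodic_def by blast
    moreover have "measure (uniform_measure M A) A = 1"
      using A False by (simp add: measure_uniform_measure emeasure_eq_measure)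
    ultimately show ?thesis by simp
  qed simp
qed

theorem (in ball_tree) ergodic_iff_uniquely_ergodic:
  assumes "level_isometry f" "homogeneous M"
  shows "ergodic M f \<longleftrightarrow> uniquely_ergodic X f"
  using ergodic_imp_uniquely_ergodic[OF assms] uniquely_ergodic_imp_ergodic[of X f M]
    homogeneous_invariant[OF assms] assms(2) by (auto simp: homogeneous_def)

section \<open>The absolute value on the rationals\<close>

locale padic =
  fixes p :: nat
  assumes prime: "prime p"
begin

abbreviation v :: "rat \<Rightarrow> real" where "v \<equiv> rat_padic_abs p"

abbreviation P :: real where "P \<equiv> real p"

lemma P_gt_1: "P > 1"
  using prime prime_gt_1_nat by fastforce

lemma prime_int: "prime (int p)"
  using prime by simp

lemma v_0 [simp]: "v 0 = 0"
  by (simp add: rat_padic_abs_def)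

text \<open>The definition reads off a reduced fraction; here the formula is extended to an arbitrary
  quotient of integers, which is what makes multiplicativity immediate.\<close>

lemma v_frac:
  fixes a b :: int
  assumes "a \<noteq> 0" "b \<noteq> 0"
  shows "v (of_int a / of_int b) = P powi (int (multiplicity (int p) b) - int (multiplicity (int p) a))"
proof -
  let ?m = "multiplicity (int p)"
  obtain c d where cd: "quotient_of (of_int a / of_int b) = (c, d)" by fastforce
  have d: "d > 0" by (rule quotient_of_denom_pos[OF cd])
  have eq: "(of_int a / of_int b :: rat) = of_int c / of_int d" by (rule quotient_of_div[OF cd])
  then have "(of_int (a * d) :: rat) = of_int (c * b)" using d assms by (simp add: field_simps)
  then have ad: "a * d = c * b" by (simp only: of_int_eq_iff)
  then have c: "c \<noteq> 0" using assms d by auto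
  have "?m (a * d) = ?m (c * b)" by (simp add: ad)
  then have "?m a + ?m d = ?m c + ?m b"
    using prime_int assms c d by (simp add: prime_elem_multiplicity_mult_distrib)
  then have "int (?m d) - int (?m c) = int (?m b) - int (?m a)" by linarith
  then show ?thesis using assms cd by (simp add: rat_padic_abs_def)
qed

lemma v_of_int:
  fixes a :: int
  assumes "a \<noteq> 0"
  shows "v (of_int a) = P powi (- int (multiplicity (int p) a))"
  using v_frac[OF assms, of 1] by simp

lemma v_nonneg [simp]: "v x \<ge> 0"
  by (simp add: rat_padic_abs_def)

lemma v_eq_0_iff [simp]: "v x = 0 \<longleftrightarrow> x = 0"
  using P_gt_1 by (auto simp: rat_padic_abs_def)

lemma rat_frac: obtains a b :: int where "(x :: rat) = of_int a / of_int b" "b \<noteq> 0" "coprime a b"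
  by (metis quotient_of_div quotient_of_coprime quotient_of_denom_pos less_irrefl surj_pair)

lemma v_mult: "v (x * y) = v x * v y"
proof (cases "x = 0 \<or> y = 0")
  case False
  obtain a b where x: "x = of_int a / of_int b" "b \<noteq> 0" using rat_frac .
  obtain c d where y: "y = of_int c / of_int d" "d \<noteq> 0" using rat_frac .
  have ac: "a \<noteq> 0" "c \<noteq> 0" using False x y by auto
  have xy: "x * y = of_int (a * c) / of_int (b * d)" using x y by simp
  have "v (x * y) = P powi ((int (multiplicity (int p) b) - int (multiplicity (int p) a)) +
                          (int (multiplicity (int p) d) - int (multiplicity (int p) c)))"
    unfolding xy using ac x y prime_int
    by (subst v_frac) (simp_all add: prime_elem_multiplicity_mult_distrib algebra_simps)
  also have "\<dots> = v x * v y"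
    unfolding x y using ac x y P_gt_1 by (simp add: v_frac power_int_add)
  finally show ?thesis .
qed auto

lemma v_1 [simp]: "v 1 = 1"
  using v_of_int[of 1] by simp

lemma v_minus [simp]: "v (- x) = v x"
proof -
  have "v (-1) * v (-1) = 1" using v_mult[of "-1" "-1"] by simp
  then have "v (-1) = 1" using v_nonneg[of "-1"] by (metis abs_of_nonneg real_sqrt_abs2 real_sqrt_one)
  then show ?thesis using v_mult[of "-1" x] by simp
qed

lemma v_minus_commute: "v (x - y) = v (y - x)"
  using v_minus[of "x - y"] by simp

text \<open>On integers, closeness is divisibility; this reduces the ultrametric inequality to the fact
  that multiples of \<open>p ^ k\<close> are closed under addition.\<close>

lemma v_of_int_le_iff:
  fixes a :: int
  shows "v (of_int a) \<le> P powi (- int k) \<longleftrightarrow> int p ^ k dvd a"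
proof (cases "a = 0")
  case False
  have "v (of_int a) \<le> P powi (- int k) \<longleftrightarrow> - int (multiplicity (int p) a) \<le> - int k"
    unfolding v_of_int[OF False] using P_gt_1
    by (metis power_int_increasing power_int_strict_increasing linorder_not_less less_imp_le)
  also have "\<dots> \<longleftrightarrow> int p ^ k dvd a"
    using False prime_int by (subst power_dvd_iff_le_multiplicity) auto
  finally show ?thesis .
qed simp

lemma v_ultra: "v (x + y) \<le> max (v x) (v y)"
proof (cases "x = 0 \<or> y = 0")
  case False
  obtain a b where x: "x = of_int a / of_int b" "b \<noteq> 0" using rat_frac .
  obtain c d where y: "y = of_int c / of_int d" "d \<noteq> 0" using rat_frac .
  have int: "v (of_int (i + j)) \<le> max (v (of_int i)) (v (of_int j))"
    if "v (of_int i) \<le> v (of_int j)" "j \<noteq> 0" for i j :: int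
  proof -
    let ?k = "multiplicity (int p) j"
    have vj: "v (of_int j) = P powi (- int ?k)" using v_of_int[OF that(2)] .
    then have "int p ^ ?k dvd i" using that v_of_int_le_iff by auto
    then have "int p ^ ?k dvd i + j" by (simp add: multiplicity_dvd)
    then show ?thesis using v_of_int_le_iff[of "i + j" ?k] vj by simp
  qed
  have int': "v (of_int (i + j)) \<le> max (v (of_int i)) (v (of_int j))"
    if "i \<noteq> 0" "j \<noteq> 0" for i j :: int
    using int[of i j] int[of j i] that by (cases "v (of_int i) \<le> v (of_int j)") (simp_all add: add.commute max.commute)
  \<comment> \<open>Clearing denominators turns the claim into the one for integers.\<close>
  let ?w = "of_int (b * d) :: rat"
  have w: "v ?w > 0" using x y v_eq_0_iff[of ?w] v_nonneg[of ?w] by (simp add: less_le)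
  have xw: "x * ?w = of_int (a * d)" and yw: "y * ?w = of_int (c * b)" using x y by simp_all
  have "v (x + y) * v ?w = v (of_int (a * d + c * b))"
    unfolding v_mult[symmetric] distrib_right xw yw by simp
  also have "\<dots> \<le> max (v (x * ?w)) (v (y * ?w))"
    unfolding xw yw using False x y by (intro int') auto
  also have "\<dots> = max (v x) (v y) * v ?w"
    unfolding v_mult using w by (simp add: max_mult_distrib_right)
  finally show ?thesis using w by simp
qed auto

lemma v_add_less: "\<lbrakk>v x < r; v y < r\<rbrakk> \<Longrightarrow> v (x + y) < r"
  using v_ultra[of x y] by linarith

lemma v_triangle: "v (x + y) \<le> v x + v y"
  using v_ultra[of x y] by (smt (verit) v_nonneg)

lemma v_diff_ultra: "v (x - y) \<le> max (v x) (v y)"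
  using v_ultra[of x "- y"] by simp

lemma v_diff_triangle: "v (x - z) \<le> v (x - y) + v (y - z)"
  using v_triangle[of "x - y" "y - z"] by simp

lemma v_of_nat_le_1: "v (of_nat m) \<le> 1"
  using v_of_int_le_iff[of "int m" 0] by simp

lemma v_of_nat_coprime:
  assumes "gcd n p = 1"
  shows "v (of_nat n) = 1"
proof -
  have "\<not> p dvd n" using assms prime by (metis gcd_nat.absorb2 not_prime_1)
  then have "multiplicity (int p) (int n) = 0" "n \<noteq> 0"
    by (auto intro!: not_dvd_imp_multiplicity_0 intro: Nat.gr0I)
  then show ?thesis using v_of_int[of "int n"] by simp
qed

text \<open>The absolute value takes only powers of \<open>p\<close> as nonzero values, so a strict bound improves to
  the next smaller power.\<close>

lemma v_less_imp_le:
  assumes "v x < P powi (j + 1)"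
  shows "v x \<le> P powi j"
proof (cases "x = 0")
  case False
  then obtain e where e: "v x = P powi e" unfolding rat_padic_abs_def by auto
  have "e < j + 1"
  proof (rule ccontr)
    assume "\<not> e < j + 1"
    then have "P powi (j + 1) \<le> P powi e" using P_gt_1 by (intro power_int_increasing) auto
    then show False using assms e by simp
  qed
  then show ?thesis unfolding e using P_gt_1 by (intro power_int_increasing) auto
qed (use P_gt_1 in simp)

text \<open>The denominator of a \<open>p\<close>-integral fraction is invertible modulo \<open>p ^ k\<close>; the witness is the
  numerator times that inverse, reduced modulo \<open>p ^ k\<close>.\<close>

lemma rat_residue:
  assumes "v x \<le> 1"
  shows "\<exists>m<p ^ k. v (x - of_nat m) \<le> P powi (- int k)"
proof -
  obtain a b where x: "x = of_int a / of_int b" "b \<noteq> 0" "coprime a b" using rat_frac .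
  have "\<not> int p dvd b"
  proof
    assume b: "int p dvd b"
    then have "\<not> int p dvd a" using x(3) prime_int by (meson coprime_common_divisor not_prime_unit)
    then have v1: "v (of_int a) = 1" using v_of_int[of a] not_dvd_imp_multiplicity_0[of "int p" a] by auto
    have vb: "v (of_int b) < 1"
    proof -
      have "v (of_int b) \<le> inverse P"
        using v_of_int_le_iff[of b 1] b by (simp add: power_int_minus)
      also have "\<dots> < 1" using P_gt_1 by (simp add: inverse_less_1_iff)
      finally show ?thesis .
    qed
    have "v x * v (of_int b) = 1" unfolding v_mult[symmetric] using v1 x by simp
    moreover have "v x * v (of_int b) \<le> 1 * v (of_int b)" using assms by (intro mult_right_mono) auto
    ultimately show False using vb by linarith
  qed
  then have vb: "v (of_int b) = 1" and cop: "coprime b (int p ^ k)"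
    using v_of_int[of b] not_dvd_imp_multiplicity_0[of "int p" b] x prime_int
    by (auto simp: prime_imp_coprime coprime_commute[of b])
  obtain y where y: "[b * y = 1] (mod (int p ^ k))" using cong_solve_coprime_int[OF cop] by blast
  define m where "m = nat ((a * y) mod int p ^ k)"
  have pk: "int p ^ k > 0" using prime prime_gt_0_nat by simp
  have m: "int m = (a * y) mod int p ^ k" unfolding m_def using pk by simp
  have "int m < int p ^ k" using pk m by simp
  then have "m < p ^ k" by (metis of_nat_less_iff of_nat_power)
  moreover have "v (x - of_nat m) \<le> P powi (- int k)"
  proof -
    have "[b * int m = a * 1] (mod (int p ^ k))"
    proof -
      have "[b * int m = b * (a * y)] (mod (int p ^ k))"
        unfolding m by (intro cong_mult cong_refl) (simp add: cong_def)
      also have "b * (a * y) = a * (b * y)" by simp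
      also have "[a * (b * y) = a * 1] (mod (int p ^ k))" by (intro cong_mult cong_refl y)
      finally show ?thesis .
    qed
    then have dv: "int p ^ k dvd a - b * int m"
      by (simp add: cong_iff_dvd_diff dvd_diff_commute)
    have "v (x - of_nat m) = v ((x - of_nat m) * of_int b)" by (simp add: v_mult vb)
    also have "(x - of_nat m) * of_int b = of_int (a - b * int m)"
      using x by (simp add: field_simps)
    finally show ?thesis using dv by (simp only: v_of_int_le_iff)
  qed
  ultimately show ?thesis by blast
qed

lemma v_principal_unit_power:
  assumes "v (x - 1) < 1"
  shows "v (x ^ k - 1) < 1"
proof (induction k)
  case (Suc k)
  have "v (x ^ k * (x - 1)) < 1"
  proof -
    have "v (x ^ k) \<le> max (v (x ^ k - 1)) (v 1)" using v_ultra[of "x ^ k - 1" 1] by simp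
    then have "v (x ^ k) \<le> 1" using Suc by simp
    then have "v (x ^ k) * v (x - 1) \<le> 1 * v (x - 1)" by (intro mult_right_mono) auto
    then show ?thesis using assms by (simp add: v_mult)
  qed
  then have "v (x ^ k * (x - 1) + (x ^ k - 1)) < 1" using Suc by (rule v_add_less)
  then show ?case by (simp add: algebra_simps)
qed simp

lemma v_principal_unit_mult:
  assumes "v (x - 1) < 1" "v (y - 1) < 1"
  shows "v (x * y - 1) < 1"
proof -
  have "v y \<le> 1" using v_ultra[of "y - 1" 1] assms by simp
  then have "v (x - 1) * v y \<le> v (x - 1) * 1" by (intro mult_left_mono) auto
  then have "v ((x - 1) * y) < 1" using assms by (simp add: v_mult)
  then have "v ((x - 1) * y + (y - 1)) < 1" using assms(2) by (rule v_add_less)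
  then show ?thesis by (simp add: algebra_simps)
qed

lemma v_sum_less:
  assumes "finite I" "\<And>i. i \<in> I \<Longrightarrow> v (f i) < 1"
  shows "v (\<Sum>i\<in>I. f i) < 1"
  using assms
proof (induction I rule: finite_induct)
  case (insert i I)
  then show ?case by (simp add: v_add_less)
qed simp

text \<open>The source of the isometry: the cofactor of \<open>x - y\<close> in \<open>x ^ n - y ^ n\<close> is a sum of \<open>n\<close> terms
  congruent to 1, so it is congruent to \<open>n\<close>, which is a unit.\<close>

lemma v_power_diff:
  assumes "v (x - 1) < 1" "v (y - 1) < 1" "gcd n p = 1"
  shows "v (x ^ n - y ^ n) = v (x - y)"
proof -
  let ?s = "\<Sum>i<n. y ^ (n - Suc i) * x ^ i"
  have "v (\<Sum>i<n. (y ^ (n - Suc i) * x ^ i - 1)) < 1"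
    using assms by (intro v_sum_less v_principal_unit_mult v_principal_unit_power) auto
  then have d: "v (?s - of_nat n) < 1" by (simp add: sum_subtractf)
  have "v ?s = 1"
  proof (rule antisym)
    show "v ?s \<le> 1" using v_ultra[of "?s - of_nat n" "of_nat n"] d v_of_nat_coprime[OF assms(3)] by simp
    have "v (of_nat n) \<le> max (v ?s) (v (?s - of_nat n))" using v_diff_ultra[of ?s "?s - of_nat n"] by simp
    then show "1 \<le> v ?s" using d v_of_nat_coprime[OF assms(3)] by (simp add: max_def split: if_splits)
  qed
  then show ?thesis by (simp add: power_diff_sumr2 v_mult)
qed

end

section \<open>The completed field as an ultrametric space\<close>

context padic
begin

lemma Cauchy_iff: "X \<in> padic_Cauchy p \<longleftrightarrow> (\<forall>e>0. \<exists>N. \<forall>i\<ge>N. \<forall>j\<ge>N. v (X i - X j) < e)"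
  by (simp add: padic_Cauchy_def)

lemma CauchyD:
  assumes "X \<in> padic_Cauchy p" "e > 0"
  obtains N where "\<And>i j. \<lbrakk>i \<ge> N; j \<ge> N\<rbrakk> \<Longrightarrow> v (X i - X j) < e"
proof -
  obtain N where "\<forall>i\<ge>N. \<forall>j\<ge>N. v (X i - X j) < e" using assms unfolding Cauchy_iff by blast
  then show ?thesis using that[of N] by blast
qed

lemma Cauchy_const [simp]: "(\<lambda>i. c) \<in> padic_Cauchy p"
  by (simp add: Cauchy_iff)

lemma Cauchy_add [simp]:
  assumes "X \<in> padic_Cauchy p" "Y \<in> padic_Cauchy p"
  shows "(\<lambda>i. X i + Y i) \<in> padic_Cauchy p"
  unfolding Cauchy_iff
proof (intro allI impI)
  fix e :: real assume e: "e > 0"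
  obtain M where M: "\<And>i j. \<lbrakk>i \<ge> M; j \<ge> M\<rbrakk> \<Longrightarrow> v (X i - X j) < e" using CauchyD[OF assms(1) e] by blast
  obtain N where N: "\<And>i j. \<lbrakk>i \<ge> N; j \<ge> N\<rbrakk> \<Longrightarrow> v (Y i - Y j) < e" using CauchyD[OF assms(2) e] by blast
  show "\<exists>N. \<forall>i\<ge>N. \<forall>j\<ge>N. v (X i + Y i - (X j + Y j)) < e"
  proof (intro exI[of _ "max M N"] allI impI)
    fix i j assume "max M N \<le> i" "max M N \<le> j"
    then show "v (X i + Y i - (X j + Y j)) < e"
      using v_add_less[OF M[of i j] N[of i j]] by (simp add: algebra_simps)
  qed
qed

lemma Cauchy_uminus [simp]:
  assumes "X \<in> padic_Cauchy p"
  shows "(\<lambda>i. - X i) \<in> padic_Cauchy p"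
  using assms unfolding Cauchy_iff by (simp add: v_minus_commute)

lemma Cauchy_diff [simp]:
  assumes "X \<in> padic_Cauchy p" "Y \<in> padic_Cauchy p"
  shows "(\<lambda>i. X i - Y i) \<in> padic_Cauchy p"
  using Cauchy_add[OF assms(1) Cauchy_uminus[OF assms(2)]] by simp

lemma Cauchy_bounded:
  assumes "X \<in> padic_Cauchy p"
  obtains B N where "B > 0" "\<And>i. i \<ge> N \<Longrightarrow> v (X i) \<le> B"
proof -
  obtain N where N: "\<And>i j. \<lbrakk>i \<ge> N; j \<ge> N\<rbrakk> \<Longrightarrow> v (X i - X j) < 1"
    using CauchyD[OF assms, of 1] by auto
  have "v (X i) \<le> v (X N) + 1" if "i \<ge> N" for i
    using v_diff_triangle[of "X i" 0 "X N"] N[of i N] that by simp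
  moreover have "v (X N) + 1 > 0" using v_nonneg[of "X N"] by linarith
  ultimately show ?thesis using that by blast
qed

text \<open>Cauchy factors are bounded from some index on, so multiplying by them preserves null sequences.\<close>

lemma null_mult:
  assumes "X \<in> padic_Cauchy p" "(\<lambda>i. v (Y i)) \<longlonglongrightarrow> 0"
  shows "(\<lambda>i. v (X i * Y i)) \<longlonglongrightarrow> 0"
proof -
  obtain B N where B: "\<And>i. i \<ge> N \<Longrightarrow> v (X i) \<le> B" using Cauchy_bounded[OF assms(1)] by blast
  have "(\<lambda>i. B * v (Y i)) \<longlonglongrightarrow> B * 0" by (intro tendsto_intros assms)
  then have "(\<lambda>i. B * v (Y i)) \<longlonglongrightarrow> 0" by simp
  moreover have "eventually (\<lambda>i. v (X i * Y i) \<le> B * v (Y i)) sequentially"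
    using eventually_ge_at_top[of N]
    by eventually_elim (auto simp: v_mult intro!: mult_right_mono B)
  ultimately show ?thesis
    by (rule tendsto_sandwich[OF always_eventually[OF allI[OF v_nonneg]] _ tendsto_const, rotated])
qed

lemma Cauchy_mult [simp]:
  assumes X: "X \<in> padic_Cauchy p" and Y: "Y \<in> padic_Cauchy p"
  shows "(\<lambda>i. X i * Y i) \<in> padic_Cauchy p"
  unfolding Cauchy_iff
proof (intro allI impI)
  fix e :: real assume e: "e > 0"
  obtain B K where B: "B > 0" "\<And>i. i \<ge> K \<Longrightarrow> v (X i) \<le> B" using Cauchy_bounded[OF X] by blast
  obtain C L where C: "C > 0" "\<And>i. i \<ge> L \<Longrightarrow> v (Y i) \<le> C" using Cauchy_bounded[OF Y] by blast
  obtain M where M: "\<And>i j. \<lbrakk>i \<ge> M; j \<ge> M\<rbrakk> \<Longrightarrow> v (X i - X j) < e / C"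
    using CauchyD[OF X, of "e / C"] e C by auto
  obtain N where N: "\<And>i j. \<lbrakk>i \<ge> N; j \<ge> N\<rbrakk> \<Longrightarrow> v (Y i - Y j) < e / B"
    using CauchyD[OF Y, of "e / B"] e B by auto
  show "\<exists>N. \<forall>i\<ge>N. \<forall>j\<ge>N. v (X i * Y i - X j * Y j) < e"
  proof (intro exI[of _ "max (max K L) (max M N)"] allI impI)
    fix i j assume ij: "max (max K L) (max M N) \<le> i" "max (max K L) (max M N) \<le> j"
    have "v (X i * (Y i - Y j)) \<le> B * v (Y i - Y j)"
      unfolding v_mult using ij by (intro mult_right_mono B) auto
    also have "\<dots> < B * (e / B)" using ij B by (intro mult_strict_left_mono N) auto
    finally have 1: "v (X i * (Y i - Y j)) < e" using B by simp
    have "v ((X i - X j) * Y j) \<le> v (X i - X j) * C"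
      unfolding v_mult using ij by (intro mult_left_mono C) auto
    also have "\<dots> < (e / C) * C" using ij C by (intro mult_strict_right_mono M) auto
    finally have 2: "v ((X i - X j) * Y j) < e" using C by simp
    show "v (X i * Y i - X j * Y j) < e"
      using v_add_less[OF 1 2] by (simp add: algebra_simps)
  qed
qed

lemma Cauchy_power [simp]:
  assumes "X \<in> padic_Cauchy p"
  shows "(\<lambda>i. X i ^ k) \<in> padic_Cauchy p"
  using assms by (induction k) auto

lemma null_add:
  assumes "(\<lambda>i. v (X i)) \<longlonglongrightarrow> 0" "(\<lambda>i. v (Y i)) \<longlonglongrightarrow> 0"
  shows "(\<lambda>i. v (X i + Y i)) \<longlonglongrightarrow> 0"
proof (rule tendsto_sandwich[OF _ _ tendsto_const])
  show "(\<lambda>i. v (X i) + v (Y i)) \<longlonglongrightarrow> 0" using tendsto_add[OF assms] by simp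
qed (auto intro!: always_eventually v_triangle)

lemma equiv_padic: "equiv (padic_Cauchy p) (padic_equiv p)"
proof (rule equivI)
  show "padic_equiv p \<subseteq> padic_Cauchy p \<times> padic_Cauchy p" by (auto simp: padic_equiv_def)
  show "refl_on (padic_Cauchy p) (padic_equiv p)" by (auto simp: refl_on_def padic_equiv_def)
  show "sym (padic_equiv p)" by (auto simp: sym_def padic_equiv_def v_minus_commute)
  show "trans (padic_equiv p)"
  proof (rule transI)
    fix X Y Z assume "(X, Y) \<in> padic_equiv p" "(Y, Z) \<in> padic_equiv p"
    then show "(X, Z) \<in> padic_equiv p"
      using null_add[of "\<lambda>i. X i - Y i" "\<lambda>i. Y i - Z i"] by (auto simp: padic_equiv_def)
  qed
qed

definition cls :: "(nat \<Rightarrow> rat) \<Rightarrow> (nat \<Rightarrow> rat) set" where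
  "cls X = padic_equiv p `` {X}"

lemma cls_eq_iff:
  assumes "X \<in> padic_Cauchy p" "Y \<in> padic_Cauchy p"
  shows "cls X = cls Y \<longleftrightarrow> (\<lambda>i. v (X i - Y i)) \<longlonglongrightarrow> 0"
  using eq_equiv_class_iff[OF equiv_padic assms] assms by (simp add: cls_def padic_equiv_def)

lemma carrier_Qp: "carrier (Qp p) = cls ` padic_Cauchy p"
  by (auto simp: Qp_def quotient_def cls_def)

lemma cls_carrier [simp]: "X \<in> padic_Cauchy p \<Longrightarrow> cls X \<in> carrier (Qp p)"
  by (simp add: carrier_Qp)

lemma carrierE:
  assumes "x \<in> carrier (Qp p)"
  obtains X where "X \<in> padic_Cauchy p" "x = cls X"
  using assms by (auto simp: carrier_Qp)

lemma cls_zero: "\<zero>\<^bsub>Qp p\<^esub> = cls (\<lambda>i. 0)" and cls_one: "\<one>\<^bsub>Qp p\<^esub> = cls (\<lambda>i. 1)"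
  by (simp_all add: Qp_def cls_def)

lemma cls_add:
  assumes "X \<in> padic_Cauchy p" "Y \<in> padic_Cauchy p"
  shows "cls X \<oplus>\<^bsub>Qp p\<^esub> cls Y = cls (\<lambda>i. X i + Y i)"
proof -
  have "congruent2 (padic_equiv p) (padic_equiv p) (\<lambda>X Y. cls (\<lambda>i. X i + Y i))"
  proof (rule congruent2I')
    fix X X' Y Y' assume "(X, X') \<in> padic_equiv p" "(Y, Y') \<in> padic_equiv p"
    then show "cls (\<lambda>i. X i + Y i) = cls (\<lambda>i. X' i + Y' i)"
      using null_add[of "\<lambda>i. X i - X' i" "\<lambda>i. Y i - Y' i"]
      by (subst cls_eq_iff) (auto simp: padic_equiv_def algebra_simps)
  qed
  from UN_equiv_class2[OF equiv_padic equiv_padic this assms]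
  show ?thesis by (simp add: Qp_def cls_def)
qed

lemma cls_mult:
  assumes "X \<in> padic_Cauchy p" "Y \<in> padic_Cauchy p"
  shows "cls X \<otimes>\<^bsub>Qp p\<^esub> cls Y = cls (\<lambda>i. X i * Y i)"
proof -
  have "congruent2 (padic_equiv p) (padic_equiv p) (\<lambda>X Y. cls (\<lambda>i. X i * Y i))"
  proof (rule congruent2I')
    fix X X' Y Y' assume *: "(X, X') \<in> padic_equiv p" "(Y, Y') \<in> padic_equiv p"
    have "(\<lambda>i. v (Y i * (X i - X' i))) \<longlonglongrightarrow> 0" "(\<lambda>i. v (X' i * (Y i - Y' i))) \<longlonglongrightarrow> 0"
      using * by (auto intro!: null_mult simp: padic_equiv_def)
    from null_add[OF this] show "cls (\<lambda>i. X i * Y i) = cls (\<lambda>i. X' i * Y' i)"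
      using * by (subst cls_eq_iff) (auto simp: padic_equiv_def algebra_simps)
  qed
  from UN_equiv_class2[OF equiv_padic equiv_padic this assms]
  show ?thesis by (simp add: Qp_def cls_def)
qed

lemma cls_pow:
  assumes "X \<in> padic_Cauchy p"
  shows "cls X [^]\<^bsub>Qp p\<^esub> (k::nat) = cls (\<lambda>i. X i ^ k)"
  using assms by (induction k) (simp_all add: nat_pow_def cls_one cls_mult mult.commute)

lemma abelian_group_Qp: "abelian_group (Qp p)"
proof (rule abelian_groupI)
  fix x assume "x \<in> carrier (Qp p)"
  then obtain X where "X \<in> padic_Cauchy p" "x = cls X" by (rule carrierE)
  then show "\<exists>y\<in>carrier (Qp p). y \<oplus>\<^bsub>Qp p\<^esub> x = \<zero>\<^bsub>Qp p\<^esub>"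
    by (intro bexI[of _ "cls (\<lambda>i. - X i)"]) (simp_all add: cls_add cls_zero)
qed (auto elim!: carrierE simp: cls_add cls_zero algebra_simps)

lemma cls_a_inv:
  assumes "X \<in> padic_Cauchy p"
  shows "\<ominus>\<^bsub>Qp p\<^esub> cls X = cls (\<lambda>i. - X i)"
  using assms
  by (intro abelian_group.minus_equality[OF abelian_group_Qp]) (simp_all add: cls_add cls_zero)

lemma cls_minus:
  assumes "X \<in> padic_Cauchy p" "Y \<in> padic_Cauchy p"
  shows "cls X \<ominus>\<^bsub>Qp p\<^esub> cls Y = cls (\<lambda>i. X i - Y i)"
  using assms by (simp add: a_minus_def cls_a_inv cls_add)

text \<open>By the reverse triangle inequality the absolute values form a real Cauchy sequence whose
  limit depends only on the class, so the definite description denotes that limit.\<close>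

lemma tendsto_padic_abs:
  assumes X: "X \<in> padic_Cauchy p"
  shows "(\<lambda>i. v (X i)) \<longlonglongrightarrow> padic_abs p (cls X)"
proof -
  have rev: "\<bar>v a - v b\<bar> \<le> v (a - b)" for a b
    using v_diff_triangle[of a 0 b] v_triangle[of "a - b" b] v_triangle[of "b - a" a]
    by (simp add: v_minus_commute)
  have "Cauchy (\<lambda>i. v (X i))"
  proof (rule metric_CauchyI)
    fix e :: real assume "e > 0"
    then obtain N where "\<And>i j. \<lbrakk>i \<ge> N; j \<ge> N\<rbrakk> \<Longrightarrow> v (X i - X j) < e" using CauchyD[OF X] by blast
    then show "\<exists>M. \<forall>m\<ge>M. \<forall>n\<ge>M. dist (v (X m)) (v (X n)) < e"
      unfolding dist_real_def using rev le_less_trans by blast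
  qed
  then obtain r where r: "(\<lambda>i. v (X i)) \<longlonglongrightarrow> r"
    using Cauchy_convergent_iff convergent_def by blast
  have "padic_abs p (cls X) = r"
    unfolding padic_abs_def
  proof (rule the_equality)
    show "\<forall>Y\<in>cls X. (\<lambda>i. v (Y i)) \<longlonglongrightarrow> r"
    proof
      fix Y assume "Y \<in> cls X"
      then have 0: "(\<lambda>i. v (X i - Y i)) \<longlonglongrightarrow> 0" by (simp add: cls_def padic_equiv_def)
      have "(\<lambda>i. v (Y i) - v (X i)) \<longlonglongrightarrow> 0"
        by (rule Lim_null_comparison[OF _ 0]) (use rev in \<open>auto simp: v_minus_commute[of "X _"] intro!: always_eventually\<close>)
      from tendsto_add[OF this r] show "(\<lambda>i. v (Y i)) \<longlonglongrightarrow> r" by simp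
    qed
    fix s assume "\<forall>Y\<in>cls X. (\<lambda>i. v (Y i)) \<longlonglongrightarrow> s"
    moreover have "X \<in> cls X" unfolding cls_def using equiv_class_self[OF equiv_padic X] .
    ultimately show "s = r" using r LIMSEQ_unique by blast
  qed
  then show ?thesis using r by simp
qed

abbreviation d :: "(nat \<Rightarrow> rat) set \<Rightarrow> (nat \<Rightarrow> rat) set \<Rightarrow> real" where "d \<equiv> padic_dist p"

lemma tendsto_d:
  assumes "X \<in> padic_Cauchy p" "Y \<in> padic_Cauchy p"
  shows "(\<lambda>i. v (X i - Y i)) \<longlonglongrightarrow> d (cls X) (cls Y)"
  using tendsto_padic_abs[OF Cauchy_diff[OF assms]] assms
  by (simp add: padic_dist_def cls_minus)

text \<open>Through this rule and \<open>tendsto_d\<close>, every statement about distances is reduced to one about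
  rational representatives from some index on.\<close>

lemma d_eqI:
  assumes "X \<in> padic_Cauchy p" "Y \<in> padic_Cauchy p" "X' \<in> padic_Cauchy p" "Y' \<in> padic_Cauchy p"
    and "eventually (\<lambda>i. v (X i - Y i) = v (X' i - Y' i)) sequentially"
  shows "d (cls X) (cls Y) = d (cls X') (cls Y')"
  using tendsto_d[OF assms(1,2)] tendsto_d[OF assms(3,4)] tendsto_cong[OF assms(5)]
    LIMSEQ_unique by blast

lemma d_commute: "d x y = d y x"
proof (cases "x \<in> carrier (Qp p) \<and> y \<in> carrier (Qp p)")
  case True
  then show ?thesis by (auto elim!: carrierE intro!: d_eqI simp: v_minus_commute)
qed (auto simp: padic_dist_def)

lemma d_ultra:
  assumes "x \<in> carrier (Qp p)" "y \<in> carrier (Qp p)" "z \<in> carrier (Qp p)"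
  shows "d x z \<le> max (d x y) (d y z)"
proof -
  obtain X Y Z where *: "X \<in> padic_Cauchy p" "x = cls X" "Y \<in> padic_Cauchy p" "y = cls Y"
    "Z \<in> padic_Cauchy p" "z = cls Z" using assms by (auto elim!: carrierE)
  have "(\<lambda>i. v (X i - Z i)) \<longlonglongrightarrow> d x z"
    "(\<lambda>i. max (v (X i - Y i)) (v (Y i - Z i))) \<longlonglongrightarrow> max (d x y) (d y z)"
    using * by (auto intro!: tendsto_max tendsto_d)
  then show ?thesis
  proof (rule LIMSEQ_le)
    show "\<exists>N. \<forall>i\<ge>N. v (X i - Z i) \<le> max (v (X i - Y i)) (v (Y i - Z i))"
      using v_ultra[of "X i - Y i" "Y i - Z i" for i] by simp
  qed
qed

lemma d_nonneg: "d x y \<ge> 0"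
proof (cases "x \<in> carrier (Qp p) \<and> y \<in> carrier (Qp p)")
  case True
  then show ?thesis by (auto elim!: carrierE intro!: LIMSEQ_le_const[OF tendsto_d])
qed (auto simp: padic_dist_def)

lemma d_eq_0_iff:
  assumes "x \<in> carrier (Qp p)" "y \<in> carrier (Qp p)"
  shows "d x y = 0 \<longleftrightarrow> x = y"
proof -
  obtain X Y where *: "X \<in> padic_Cauchy p" "x = cls X" "Y \<in> padic_Cauchy p" "y = cls Y"
    using assms by (auto elim!: carrierE)
  show ?thesis
    using tendsto_d[OF *(1,3)] LIMSEQ_unique unfolding *(2,4) cls_eq_iff[OF *(1,3)] by metis
qed

end

sublocale padic \<subseteq> Q: Metric_space "carrier (Qp p)" "padic_dist p"
proof
  fix x y z assume *: "x \<in> carrier (Qp p)" "y \<in> carrier (Qp p)" "z \<in> carrier (Qp p)"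
  show "padic_dist p x z \<le> padic_dist p x y + padic_dist p y z"
    using d_ultra[OF *] d_nonneg[of x y] d_nonneg[of y z] by linarith
qed (auto simp: d_nonneg d_commute d_eq_0_iff)

section \<open>Balls and residues in the p-adic integers\<close>

context padic
begin

definition near :: "nat \<Rightarrow> (nat \<Rightarrow> rat) set \<Rightarrow> (nat \<Rightarrow> rat) set \<Rightarrow> bool" where
  "near k x y \<longleftrightarrow> d x y \<le> P powi (- int k)"

lemma P_powi_pos: "P powi k > 0"
  using P_gt_1 by simp

lemma near_mono: "\<lbrakk>j \<le> k; near k x y\<rbrakk> \<Longrightarrow> near j x y"
  using P_gt_1 power_int_increasing[of "- int k" "- int j" P] unfolding near_def by linarith

lemma near_refl: "x \<in> carrier (Qp p) \<Longrightarrow> near k x x"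
  using P_powi_pos[of "- int k"] by (simp add: near_def)

lemma near_commute: "near k x y \<longleftrightarrow> near k y x"
  by (simp add: near_def d_commute)

lemma near_trans:
  assumes "x \<in> carrier (Qp p)" "y \<in> carrier (Qp p)" "z \<in> carrier (Qp p)" "near k x y" "near k y z"
  shows "near k x z"
  using d_ultra[OF assms(1-3)] assms(4,5) by (simp add: near_def)

lemma near_clsI:
  assumes "X \<in> padic_Cauchy p" "Y \<in> padic_Cauchy p"
    and "eventually (\<lambda>i. v (X i - Y i) \<le> P powi (- int k)) sequentially"
  shows "near k (cls X) (cls Y)"
  unfolding near_def by (rule tendsto_upperbound[OF tendsto_d[OF assms(1,2)] assms(3)]) simp

definition of_nat_Qp :: "nat \<Rightarrow> (nat \<Rightarrow> rat) set" where
  "of_nat_Qp m = cls (\<lambda>i. of_nat m)"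

lemma of_nat_Qp_carrier [simp]: "of_nat_Qp m \<in> carrier (Qp p)"
  by (simp add: of_nat_Qp_def)

lemma padic_abs_eq_d: "x \<in> carrier (Qp p) \<Longrightarrow> padic_abs p x = d x \<zero>\<^bsub>Qp p\<^esub>"
  by (auto elim!: carrierE simp: padic_dist_def cls_zero cls_minus)

lemma Zp_iff: "x \<in> Zp p \<longleftrightarrow> x \<in> carrier (Qp p) \<and> d x \<zero>\<^bsub>Qp p\<^esub> \<le> 1"
  by (auto simp: Zp_def padic_abs_eq_d)

lemma Zp_carrier: "x \<in> Zp p \<Longrightarrow> x \<in> carrier (Qp p)"
  by (simp add: Zp_def)

lemma cls_Zp: 
  assumes "X \<in> padic_Cauchy p" "eventually (\<lambda>i. v (X i) \<le> 1) sequentially"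
  shows "cls X \<in> Zp p"
  using assms near_clsI[of X "\<lambda>i. 0" 0] by (simp add: Zp_iff near_def cls_zero)

lemma cls_d_less:
  assumes "X \<in> padic_Cauchy p" "Y \<in> padic_Cauchy p" "d (cls X) (cls Y) < r"
  shows "eventually (\<lambda>i. v (X i - Y i) < r) sequentially"
  using order_tendstoD(2)[OF tendsto_d[OF assms(1,2)] assms(3)] .

text \<open>A representative is eventually \<open>p\<close>-integral by discreteness of the absolute value, and
  eventually constant modulo \<open>p ^ k\<close>; the residue of one late enough term serves for all.\<close>

lemma Zp_residue:
  assumes "x \<in> Zp p"
  shows "\<exists>m<p ^ k. near k x (of_nat_Qp m)"
proof -
  obtain X where X: "X \<in> padic_Cauchy p" "x = cls X" using assms Zp_carrier carrierE by metis
  have "d (cls X) (cls (\<lambda>i. 0)) < P"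
    using assms X P_gt_1 by (auto simp: Zp_iff cls_zero)
  from cls_d_less[OF X(1) Cauchy_const this]
  obtain M where M: "\<And>i. i \<ge> M \<Longrightarrow> v (X i) < P" by (auto simp: eventually_sequentially)
  obtain N where N: "\<And>i j. \<lbrakk>i \<ge> N; j \<ge> N\<rbrakk> \<Longrightarrow> v (X i - X j) < P powi (- int k)"
    using CauchyD[OF X(1) P_powi_pos] by blast
  let ?K = "max M N"
  have "v (X ?K) \<le> 1" using v_less_imp_le[of "X ?K" 0] M[of ?K] by simp
  from rat_residue[OF this, of k] obtain m
    where m: "m < p ^ k" "v (X ?K - of_nat m) \<le> P powi (- int k)" by blast
  have "near k x (of_nat_Qp m)"
    unfolding X of_nat_Qp_def
  proof (rule near_clsI)
    show "eventually (\<lambda>i. v (X i - of_nat m) \<le> P powi (- int k)) sequentially"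
      using eventually_ge_at_top[of ?K]
    proof eventually_elim
      case (elim i)
      then have "v (X i - X ?K) \<le> P powi (- int k)" using N[of i ?K] by simp
      then show ?case using v_ultra[of "X i - X ?K" "X ?K - of_nat m"] m(2) by simp
    qed
  qed (use X in simp_all)
  then show ?thesis using m by blast
qed

lemma d_of_int: "d (cls (\<lambda>i. of_int a)) (cls (\<lambda>i. of_int b)) = v (of_int (a - b))"
  using LIMSEQ_unique[OF tendsto_d[of "\<lambda>i. of_int a" "\<lambda>i. of_int b"] tendsto_const] by simp

lemma near_of_nat_iff: "near k (of_nat_Qp a) (of_nat_Qp b) \<longleftrightarrow> int p ^ k dvd int a - int b"
  using d_of_int[of "int a" "int b"] v_of_int_le_iff[of "int a - int b" k]
  by (simp add: near_def of_nat_Qp_def)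

lemma residue_unique:
  assumes "a < p ^ k" "b < p ^ k" "near k (of_nat_Qp a) (of_nat_Qp b)"
  shows "a = b"
proof -
  have "int p ^ k dvd int a - int b" using assms(3) near_of_nat_iff by simp
  then have "int a mod int (p ^ k) = int b mod int (p ^ k)" by (simp add: mod_eq_dvd_iff)
  then show ?thesis using assms by simp
qed

text \<open>Residues modulo powers of \<open>p\<close> make each level finite. The shift \<open>c\<close> lets the tree of a subset
  start at balls so small that they lie inside it; on a sphere, larger balls would be cut off.\<close>

lemma ball_tree_subspace:
  assumes S: "S \<subseteq> Zp p"
  shows "ball_tree (subtopology (padic_topology p) S) (\<lambda>k. near (k + c))"
    and "topspace (subtopology (padic_topology p) S) = S"
proof -
  have SQ: "S \<subseteq> carrier (Qp p)" using S Zp_carrier by blast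
  show top: "topspace (subtopology (padic_topology p) S) = S"
    using SQ by (auto simp: padic_topology_def)
  show "ball_tree (subtopology (padic_topology p) S) (\<lambda>k. near (k + c))"
  proof (unfold_locales, unfold top)
    fix k x y z assume "x \<in> S" "y \<in> S" "z \<in> S" "near (k + c) x y" "near (k + c) y z"
    then show "near (k + c) x z" using near_trans[of x y z] SQ by blast
  next
    fix k x y assume "near (Suc k + c) x y"
    then show "near (k + c) x y" by (rule near_mono[rotated]) simp
  next
    fix k
    \<comment> \<open>Each ball is also the ball around the residue of its centre, and there are \<open>p ^ (k + c)\<close> residues.\<close>
    have "(\<lambda>x. {y \<in> S. near (k + c) x y}) ` S
        \<subseteq> (\<lambda>m. {y \<in> S. near (k + c) (of_nat_Qp m) y}) ` {..<p ^ (k + c)}"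
    proof
      fix C assume "C \<in> (\<lambda>x. {y \<in> S. near (k + c) x y}) ` S"
      then obtain x where x: "x \<in> S" "C = {y \<in> S. near (k + c) x y}" by blast
      obtain m where m: "m < p ^ (k + c)" "near (k + c) x (of_nat_Qp m)"
        using Zp_residue S x by blast
      have "near (k + c) x y \<longleftrightarrow> near (k + c) (of_nat_Qp m) y" if "y \<in> S" for y
        using near_trans[of x "of_nat_Qp m" y "k + c"] near_trans[of "of_nat_Qp m" x y "k + c"]
          m near_commute that x(1) SQ of_nat_Qp_carrier by blast
      then show "C \<in> (\<lambda>m. {y \<in> S. near (k + c) (of_nat_Qp m) y}) ` {..<p ^ (k + c)}"
        using x m by blast
    qed
    then show "finite ((\<lambda>x. {y \<in> S. near (k + c) x y}) ` S)" by (rule finite_subset) simp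
  next
    fix U
    show "openin (subtopology (padic_topology p) S) U \<longleftrightarrow>
      U \<subseteq> S \<and> (\<forall>x\<in>U. \<exists>k. {y \<in> S. near (k + c) x y} \<subseteq> U)" (is "?L \<longleftrightarrow> ?R")
    proof
      assume ?L
      then obtain T where T: "openin (padic_topology p) T" "U = T \<inter> S"
        by (auto simp: openin_subtopology)
      have "\<exists>k. {y \<in> S. near (k + c) x y} \<subseteq> U" if x: "x \<in> U" for x
      proof -
        obtain r where r: "r > 0" "Q.mball x r \<subseteq> T"
          using T x unfolding padic_topology_def Q.openin_mtopology by blast
        obtain k where k: "(1 / P) ^ k < r" using real_arch_pow_inv[OF r(1), of "1 / P"] P_gt_1 by auto
        have "P powi (- int (k + c)) \<le> P powi (- int k)"
          using P_gt_1 by (intro power_int_increasing) auto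
        also have "\<dots> = (1 / P) ^ k" by (simp add: power_int_minus power_one_over field_simps)
        finally have "near (k + c) x y \<Longrightarrow> d x y < r" for y using k by (simp add: near_def)
        then have "{y \<in> S. near (k + c) x y} \<subseteq> U"
          using r x T SQ by (auto simp: subset_iff)
        then show ?thesis by blast
      qed
      then show ?R using T by blast
    next
      assume R: ?R
      define T where "T = \<Union>{Q.mball x r | x r. Q.mball x r \<inter> S \<subseteq> U}"
      have "openin Q.mtopology T" unfolding T_def by (intro openin_Union) auto
      moreover have "U = T \<inter> S"
      proof
        show "U \<subseteq> T \<inter> S"
        proof
          fix x assume x: "x \<in> U"
          then obtain k where k: "{y \<in> S. near (k + c) x y} \<subseteq> U" using R by blast
          let ?r = "P powi (- int (k + c))"
          have "Q.mball x ?r \<inter> S \<subseteq> U" using k by (auto simp: near_def)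
          moreover have "x \<in> Q.mball x ?r" using P_powi_pos x R SQ by auto
          ultimately show "x \<in> T \<inter> S" using x R unfolding T_def by blast
        qed
        show "T \<inter> S \<subseteq> U" unfolding T_def by blast
      qed
      ultimately show ?L unfolding padic_topology_def openin_subtopology by blast
    qed
  qed (use SQ near_refl near_commute in auto)
qed

lemma d_translate:
  assumes "a \<in> carrier (Qp p)" "x \<in> carrier (Qp p)" "y \<in> carrier (Qp p)"
  shows "d (a \<oplus>\<^bsub>Qp p\<^esub> x) (a \<oplus>\<^bsub>Qp p\<^esub> y) = d x y"
  using assms by (auto elim!: carrierE simp: cls_add intro!: d_eqI)

lemma Zp_add:
  assumes "a \<in> Zp p" "x \<in> Zp p"
  shows "a \<oplus>\<^bsub>Qp p\<^esub> x \<in> Zp p"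
proof -
  interpret abelian_group "Qp p" by (rule abelian_group_Qp)
  note c = assms[THEN Zp_carrier]
  have "d (a \<oplus>\<^bsub>Qp p\<^esub> x) (a \<oplus>\<^bsub>Qp p\<^esub> \<zero>\<^bsub>Qp p\<^esub>) \<le> 1"
    using assms c by (simp only: d_translate zero_closed Zp_iff)
  then have "d (a \<oplus>\<^bsub>Qp p\<^esub> x) a \<le> 1" using c by simp
  then show ?thesis
    using d_ultra[of "a \<oplus>\<^bsub>Qp p\<^esub> x" a "\<zero>\<^bsub>Qp p\<^esub>"] assms c by (auto simp: Zp_iff)
qed

lemma Zp_uminus:
  assumes "a \<in> Zp p"
  shows "\<ominus>\<^bsub>Qp p\<^esub> a \<in> Zp p"
proof -
  interpret abelian_group "Qp p" by (rule abelian_group_Qp)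
  note c = assms[THEN Zp_carrier]
  have "d (a \<oplus>\<^bsub>Qp p\<^esub> \<ominus>\<^bsub>Qp p\<^esub> a) (a \<oplus>\<^bsub>Qp p\<^esub> \<zero>\<^bsub>Qp p\<^esub>) = d (\<ominus>\<^bsub>Qp p\<^esub> a) \<zero>\<^bsub>Qp p\<^esub>"
    using c by (intro d_translate) auto
  then have "d \<zero>\<^bsub>Qp p\<^esub> a = d (\<ominus>\<^bsub>Qp p\<^esub> a) \<zero>\<^bsub>Qp p\<^esub>" using c by (simp add: r_neg)
  then show ?thesis using assms c by (simp add: Zp_iff d_commute)
qed

abbreviation Zp_top where "Zp_top \<equiv> subtopology (padic_topology p) (Zp p)"

lemma topspace_padic [simp]: "topspace (padic_topology p) = carrier (Qp p)"
  by (simp add: padic_topology_def)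

lemma carrier_Int_Zp [simp]: "carrier (Qp p) \<inter> Zp p = Zp p"
  using Zp_carrier by blast

end

sublocale padic \<subseteq> Z: ball_tree "subtopology (padic_topology p) (Zp p)" "padic.near p"
  using ball_tree_subspace(1)[OF order_refl, of 0] by simp

context padic
begin

lemma translation_isometry:
  assumes "a \<in> Zp p"
  shows "Z.level_isometry (\<lambda>x. a \<oplus>\<^bsub>Qp p\<^esub> x)"
  using assms Zp_add d_translate Zp_carrier by (auto simp: Z.level_isometry_def near_def)

text \<open>Translations are isometries, so homogeneous measures are translation-invariant; conversely any
  two balls of equal radius are translates of each other.\<close>

lemma is_Haar_iff_homogeneous: "is_Haar_Zp p M \<longleftrightarrow> Z.homogeneous M"
proof
  interpret abelian_group "Qp p" by (rule abelian_group_Qp)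
  assume M: "Z.homogeneous M"
  interpret M: prob_space M using M by (simp add: Z.homogeneous_def)
  have sM: "sets M = sets (borel_of Zp_top)" using M by (simp add: Z.homogeneous_def)
  have sp: "space M = Zp p" using sets_eq_imp_space_eq[OF sM] Z.space_borel_of by simp
  have "emeasure M ((\<lambda>x. a \<oplus>\<^bsub>Qp p\<^esub> x) ` A) = emeasure M A" if a: "a \<in> Zp p" and A: "A \<in> sets M" for a A
  proof -
    let ?g = "\<lambda>x. \<ominus>\<^bsub>Qp p\<^esub> a \<oplus>\<^bsub>Qp p\<^esub> x"
    have na: "\<ominus>\<^bsub>Qp p\<^esub> a \<in> Zp p" by (rule Zp_uminus[OF a])
    have inv: "invariant_prob M ?g"
      by (rule Z.homogeneous_invariant[OF translation_isometry[OF na] M])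
    have AZ: "A \<subseteq> Zp p" using sets.sets_into_space[OF A] sp by simp
    have "(\<lambda>x. a \<oplus>\<^bsub>Qp p\<^esub> x) ` A = ?g -` A \<inter> space M"
    proof (rule subset_antisym; rule subsetI)
      fix y assume "y \<in> (\<lambda>x. a \<oplus>\<^bsub>Qp p\<^esub> x) ` A"
      then obtain x where x: "x \<in> A" "y = a \<oplus>\<^bsub>Qp p\<^esub> x" by blast
      have "?g y = x" using a AZ x Zp_carrier by (simp add: a_assoc[symmetric] l_neg subset_iff)
      then show "y \<in> ?g -` A \<inter> space M" using x AZ Zp_add[OF a] sp by auto
    next
      fix y assume y: "y \<in> ?g -` A \<inter> space M"
      then have "a \<oplus>\<^bsub>Qp p\<^esub> ?g y = y"
        using a sp Zp_carrier by (simp add: a_assoc[symmetric] r_neg)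
      then show "y \<in> (\<lambda>x. a \<oplus>\<^bsub>Qp p\<^esub> x) ` A" using y by (metis IntD1 imageI vimageE)
    qed
    moreover have "emeasure M (?g -` A \<inter> space M) = emeasure (distr M M ?g) A"
      using inv A by (intro emeasure_distr[symmetric]) (simp_all add: invariant_prob_def)
    moreover have "distr M M ?g = M" using inv by (simp add: invariant_prob_def)
    ultimately show ?thesis by simp
  qed
  then show "is_Haar_Zp p M" using sM M.emeasure_space_1 sp by (simp add: is_Haar_Zp_def)
next
  interpret abelian_group "Qp p" by (rule abelian_group_Qp)
  assume M: "is_Haar_Zp p M"
  have sM: "sets M = sets (borel_of Zp_top)" using M by (simp add: is_Haar_Zp_def)
  have sp: "space M = Zp p" using sets_eq_imp_space_eq[OF sM] Z.space_borel_of by simp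
  have "measure M (Z.cell k x) = measure M (Z.cell k y)" if xy: "x \<in> Zp p" "y \<in> Zp p" for k x y
  proof -
    let ?a = "y \<oplus>\<^bsub>Qp p\<^esub> \<ominus>\<^bsub>Qp p\<^esub> x" and ?b = "x \<oplus>\<^bsub>Qp p\<^esub> \<ominus>\<^bsub>Qp p\<^esub> y"
    note c = xy[THEN Zp_carrier]
    have a: "?a \<in> Zp p" and b: "?b \<in> Zp p" using xy by (auto intro: Zp_add Zp_uminus)
    have ax: "?a \<oplus>\<^bsub>Qp p\<^esub> x = y" using c by (simp add: a_assoc l_neg)
    have bb: "?b \<oplus>\<^bsub>Qp p\<^esub> y = x" using c by (simp add: a_assoc l_neg)
    have "(\<lambda>z. ?a \<oplus>\<^bsub>Qp p\<^esub> z) ` Z.cell k x = Z.cell k y"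
    proof (rule subset_antisym; rule subsetI)
      fix w assume "w \<in> (\<lambda>z. ?a \<oplus>\<^bsub>Qp p\<^esub> z) ` Z.cell k x"
      then obtain z where z: "z \<in> Zp p" "near k x z" "w = ?a \<oplus>\<^bsub>Qp p\<^esub> z"
        by (auto simp: Z.cell_def)
      have "near k (?a \<oplus>\<^bsub>Qp p\<^esub> x) (?a \<oplus>\<^bsub>Qp p\<^esub> z)"
        using d_translate[of ?a x z] z c a Zp_carrier by (simp add: near_def)
      then show "w \<in> Z.cell k y" using z Zp_add[OF a] by (simp add: ax Z.cell_def)
    next
      fix w assume "w \<in> Z.cell k y"
      then have w: "w \<in> Zp p" "near k y w" by (auto simp: Z.cell_def)
      have "near k (?b \<oplus>\<^bsub>Qp p\<^esub> y) (?b \<oplus>\<^bsub>Qp p\<^esub> w)"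
        using d_translate[of ?b y w] w c b Zp_carrier by (simp add: near_def)
      then have "?b \<oplus>\<^bsub>Qp p\<^esub> w \<in> Z.cell k x" using w Zp_add[OF b] by (simp add: bb Z.cell_def)
      moreover have "?a \<oplus>\<^bsub>Qp p\<^esub> (?b \<oplus>\<^bsub>Qp p\<^esub> w) = w"
      proof -
        have "?a \<oplus>\<^bsub>Qp p\<^esub> ?b = \<zero>\<^bsub>Qp p\<^esub>"
          using c by (metis a_assoc a_inv_closed l_neg r_neg r_zero l_zero a_closed)
        then show ?thesis using a b w Zp_carrier by (simp add: a_assoc[symmetric])
      qed
      ultimately show "w \<in> (\<lambda>z. ?a \<oplus>\<^bsub>Qp p\<^esub> z) ` Z.cell k x" by (metis imageI)
    qed
    moreover have "Z.cell k x \<in> sets M" using Z.cell_sets[of x k] xy sM by simp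
    ultimately have "emeasure M (Z.cell k y) = emeasure M (Z.cell k x)"
      using M a unfolding is_Haar_Zp_def by metis
    then show ?thesis by (simp add: measure_def)
  qed
  moreover have "prob_space M" using M sp by (intro prob_spaceI) (simp add: is_Haar_Zp_def)
  ultimately show "Z.homogeneous M"
    unfolding Z.homogeneous_def topspace_subtopology topspace_padic carrier_Int_Zp
    using sM by blast
qed

end

section \<open>Haar measure from random digits\<close>

context padic
begin

definition partial_value :: "nat \<Rightarrow> (nat \<Rightarrow> nat) \<Rightarrow> nat" where
  "partial_value k \<omega> = (\<Sum>j<k. \<omega> j * p ^ j)"

text \<open>The sum of the series \<open>\<Sum>j. \<omega> j * p ^ j\<close>, which converges \<open>p\<close>-adically for every sequence of
  natural numbers, digits or not.\<close>

definition digit_value :: "(nat \<Rightarrow> nat) \<Rightarrow> (nat \<Rightarrow> rat) set" where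
  "digit_value \<omega> = cls (\<lambda>i. of_nat (partial_value i \<omega>))"

lemma partial_value_diff:
  assumes "k \<le> i"
  shows "v (of_nat (partial_value i \<omega>) - of_nat (partial_value k \<omega>)) \<le> P powi (- int k)"
proof -
  have "p ^ k dvd (\<Sum>j\<in>{k..<i}. \<omega> j * p ^ j)"
    by (intro dvd_sum dvd_mult le_imp_power_dvd) simp
  moreover have eq: "partial_value i \<omega> = partial_value k \<omega> + (\<Sum>j\<in>{k..<i}. \<omega> j * p ^ j)"
    using assms by (simp add: partial_value_def lessThan_atLeast0 sum.atLeastLessThan_concat)
  ultimately have "int p ^ k dvd int (\<Sum>j\<in>{k..<i}. \<omega> j * p ^ j)"
    by (metis of_nat_dvd_iff of_nat_power)
  then have "v (of_int (int (\<Sum>j\<in>{k..<i}. \<omega> j * p ^ j))) \<le> P powi (- int k)"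
    by (simp only: v_of_int_le_iff)
  then show ?thesis unfolding eq by simp
qed

lemma partial_value_Cauchy: "(\<lambda>i. of_nat (partial_value i \<omega>)) \<in> padic_Cauchy p"
  unfolding Cauchy_iff
proof (intro allI impI)
  fix e :: real assume "e > 0"
  then obtain k where "(1 / P) ^ k < e" using real_arch_pow_inv[of e "1 / P"] P_gt_1 by auto
  then have k: "P powi (- int k) < e" by (simp add: power_int_minus power_one_over field_simps)
  show "\<exists>N. \<forall>i\<ge>N. \<forall>j\<ge>N. v (of_nat (partial_value i \<omega>) - of_nat (partial_value j \<omega>)) < e"
  proof (intro exI[of _ k] allI impI)
    fix i j assume "k \<le> i" "k \<le> j"
    then have "v (of_nat (partial_value i \<omega>) - of_nat (partial_value k \<omega>)) < e"
      "v (of_nat (partial_value k \<omega>) - of_nat (partial_value j \<omega>)) < e"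
      using partial_value_diff k v_minus_commute by (metis le_less_trans)+
    from v_add_less[OF this]
    show "v (of_nat (partial_value i \<omega>) - of_nat (partial_value j \<omega>)) < e" by simp
  qed
qed

lemma digit_value_Zp: "digit_value \<omega> \<in> Zp p"
  unfolding digit_value_def
  by (intro cls_Zp partial_value_Cauchy always_eventually allI v_of_nat_le_1)

lemma digit_value_near: "near k (digit_value \<omega>) (of_nat_Qp (partial_value k \<omega>))"
  unfolding digit_value_def of_nat_Qp_def
  by (rule near_clsI[OF partial_value_Cauchy Cauchy_const])
     (auto simp: eventually_sequentially intro: partial_value_diff)

lemma partial_value_less:
  assumes "\<And>j. \<omega> j < p"
  shows "partial_value k \<omega> < p ^ k"
proof (induction k)
  case (Suc k)
  have "partial_value (Suc k) \<omega> < p ^ k + \<omega> k * p ^ k"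
    using Suc by (simp add: partial_value_def)
  also have "\<dots> = Suc (\<omega> k) * p ^ k" by simp
  also have "\<dots> \<le> p * p ^ k" using assms[of k] by (intro mult_right_mono) auto
  finally show ?case by simp
qed (simp add: partial_value_def)

text \<open>Existence and uniqueness of the base-\<open>p\<close> expansion, in the form that identifies the sequences
  with a given partial value as a cylinder set.\<close>

lemma digit_expansion:
  assumes "m < p ^ k"
  shows "\<exists>\<delta>. (\<forall>j<k. \<delta> j < p) \<and>
    (\<forall>\<omega>. (\<forall>j. \<omega> j < p) \<longrightarrow> (partial_value k \<omega> = m \<longleftrightarrow> (\<forall>j<k. \<omega> j = \<delta> j)))"
  using assms
proof (induction k arbitrary: m)
  case (Suc k)
  have pk: "p ^ k > 0" using prime prime_gt_0_nat by simp
  then have "m mod p ^ k < p ^ k" by simp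
  from Suc.IH[OF this] obtain \<delta> where \<delta>: "\<And>j. j < k \<Longrightarrow> \<delta> j < p"
    "\<And>\<omega>. (\<And>j. \<omega> j < p) \<Longrightarrow> partial_value k \<omega> = m mod p ^ k \<longleftrightarrow> (\<forall>j<k. \<omega> j = \<delta> j)"
    by blast
  \<comment> \<open>The leading digit of \<open>m\<close>; the lower ones come from its remainder.\<close>
  have dig: "m div p ^ k < p" using Suc.prems pk by (simp add: less_mult_imp_div_less)
  have "partial_value (Suc k) \<omega> = m \<longleftrightarrow> (\<forall>j<Suc k. \<omega> j = (\<delta>(k := m div p ^ k)) j)"
    if \<omega>: "\<And>j. \<omega> j < p" for \<omega>
  proof -
    have lt: "partial_value k \<omega> < p ^ k" by (rule partial_value_less[OF \<omega>])
    have step: "partial_value (Suc k) \<omega> = partial_value k \<omega> + \<omega> k * p ^ k"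
      by (simp add: partial_value_def)
    have "partial_value (Suc k) \<omega> = m \<longleftrightarrow> partial_value k \<omega> = m mod p ^ k \<and> \<omega> k = m div p ^ k"
    proof
      assume "partial_value (Suc k) \<omega> = m"
      then show "partial_value k \<omega> = m mod p ^ k \<and> \<omega> k = m div p ^ k"
        using lt pk unfolding step by auto
    next
      assume "partial_value k \<omega> = m mod p ^ k \<and> \<omega> k = m div p ^ k"
      then show "partial_value (Suc k) \<omega> = m" unfolding step by (simp only: mod_div_mult_eq)
    qed
    then show ?thesis using \<delta>(2)[OF \<omega>] by (auto simp: less_Suc_eq)
  qed
  then show ?case using \<delta>(1) dig
    by (intro exI[of _ "\<delta>(k := m div p ^ k)"]) (auto simp: less_Suc_eq)
qed (simp add: partial_value_def)

definition digit_measure :: "(nat \<Rightarrow> nat) measure" where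
  "digit_measure = PiM UNIV (\<lambda>_. uniform_count_measure {..<p})"

lemma space_digit_measure: "\<omega> \<in> space digit_measure \<longleftrightarrow> (\<forall>j. \<omega> j < p)"
  by (auto simp: digit_measure_def space_PiM PiE_iff space_uniform_count_measure)

text \<open>A ball of radius \<open>p^(-k)\<close> is a residue class modulo \<open>p ^ k\<close>, so landing in it fixes precisely
  the first \<open>k\<close> digits.\<close>

lemma digit_measure_cell:
  assumes "x \<in> Zp p"
  shows "digit_value -` Z.cell k x \<inter> space digit_measure \<in> sets digit_measure"
    and "emeasure digit_measure (digit_value -` Z.cell k x \<inter> space digit_measure) = ennreal (1 / P) ^ k"
proof -
  have p0: "{..<p} \<noteq> {}" using prime prime_gt_0_nat by auto
  interpret F: prob_space "uniform_count_measure {..<p}"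
    using p0 by (intro prob_space_uniform_count_measure) auto
  interpret product_prob_space "\<lambda>_::nat. uniform_count_measure {..<p}" UNIV ..
  obtain m where m: "m < p ^ k" "near k x (of_nat_Qp m)" using Zp_residue[OF assms] by blast
  obtain \<delta> where \<delta>: "\<And>j. j < k \<Longrightarrow> \<delta> j < p"
    "\<And>\<omega>. (\<And>j. \<omega> j < p) \<Longrightarrow> partial_value k \<omega> = m \<longleftrightarrow> (\<forall>j<k. \<omega> j = \<delta> j)"
    using digit_expansion[OF m(1)] by blast
  have mem: "digit_value \<omega> \<in> Z.cell k x \<longleftrightarrow> (\<forall>j<k. \<omega> j = \<delta> j)" if \<omega>: "\<And>j. \<omega> j < p" for \<omega>
  proof -
    note c = Zp_carrier[OF assms] Zp_carrier[OF digit_value_Zp[of \<omega>]] of_nat_Qp_carrier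
    have "digit_value \<omega> \<in> Z.cell k x \<longleftrightarrow> near k x (digit_value \<omega>)"
      using digit_value_Zp by (simp add: Z.cell_def)
    also have "\<dots> \<longleftrightarrow> near k (of_nat_Qp (partial_value k \<omega>)) (of_nat_Qp m)"
      using near_trans near_commute c m(2) digit_value_near[of k \<omega>] by metis
    also have "\<dots> \<longleftrightarrow> partial_value k \<omega> = m"
      using residue_unique[OF partial_value_less[OF \<omega>] m(1)] near_refl by auto
    finally show ?thesis using \<delta>(2)[OF \<omega>] by simp
  qed
  have eq: "digit_value -` Z.cell k x \<inter> space digit_measure
      = {\<omega> \<in> space (PiM UNIV (\<lambda>_. uniform_count_measure {..<p})). \<forall>j\<in>{..<k}. \<omega> j \<in> {\<delta> j}}"
    unfolding digit_measure_def[symmetric] using mem space_digit_measure by auto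
  have sets: "{\<delta> j} \<in> sets (uniform_count_measure {..<p})" if "j \<in> {..<k}" for j
    using \<delta>(1) that by (simp add: sets_uniform_count_measure)
  show "digit_value -` Z.cell k x \<inter> space digit_measure \<in> sets digit_measure"
    unfolding eq unfolding digit_measure_def using sets
    by (intro sets.sets_Collect_finite_All sets_Collect_single) auto
  have "emeasure digit_measure (digit_value -` Z.cell k x \<inter> space digit_measure)
      = (\<Prod>j<k. emeasure (uniform_count_measure {..<p}) {\<delta> j})"
    unfolding eq unfolding digit_measure_def using sets by (intro emeasure_PiM_Collect) auto
  also have "\<dots> = (\<Prod>j<k. ennreal (1 / P))"
    using \<delta>(1) by (intro prod.cong refl) (simp add: emeasure_uniform_count_measure)
  finally show "emeasure digit_measure (digit_value -` Z.cell k x \<inter> space digit_measure)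
      = ennreal (1 / P) ^ k" by simp
qed

lemma digit_value_measurable: "digit_value \<in> measurable digit_measure (borel_of Zp_top)"
proof (rule measurable_sigma_sets[OF Z.sets_borel_cells])
  show "insert {} Z.cells \<subseteq> Pow (topspace Zp_top)" using Z.cell_subset by (auto simp: Z.cells_def)
  show "digit_value \<in> space digit_measure \<rightarrow> topspace Zp_top" using digit_value_Zp by simp
  fix C assume "C \<in> insert {} Z.cells"
  then show "digit_value -` C \<inter> space digit_measure \<in> sets digit_measure"
    using digit_measure_cell(1) by (auto simp: Z.cells_def)
qed

lemma homogeneous_digit_value: "Z.homogeneous (distr digit_measure (borel_of Zp_top) digit_value)"
  unfolding Z.homogeneous_def
proof (intro conjI allI ballI)
  have "prob_space digit_measure"
    unfolding digit_measure_def using prime prime_gt_0_nat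
    by (intro prob_space_PiM prob_space_uniform_count_measure) auto
  then show "prob_space (distr digit_measure (borel_of Zp_top) digit_value)"
    by (rule prob_space.prob_space_distr[OF _ digit_value_measurable])
  have cell: "measure (distr digit_measure (borel_of Zp_top) digit_value) (Z.cell k x)
      = enn2real (ennreal (1 / P) ^ k)" if "x \<in> topspace Zp_top" for k x
    using Z.cell_sets[OF that] digit_measure_cell(2)[of x k] that
    by (simp add: measure_def emeasure_distr[OF digit_value_measurable])
  fix k x y assume "x \<in> topspace Zp_top" "y \<in> topspace Zp_top"
  then show "measure (distr digit_measure (borel_of Zp_top) digit_value) (Z.cell k x)
      = measure (distr digit_measure (borel_of Zp_top) digit_value) (Z.cell k y)"
    using cell by simp
qed simp

lemma homogeneous_Haar: "Z.homogeneous (Haar_Zp p)"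
  unfolding Haar_Zp_def is_Haar_iff_homogeneous
  by (rule theI[of Z.homogeneous, OF homogeneous_digit_value])
     (rule Z.homogeneous_unique[OF _ homogeneous_digit_value])

text \<open>The balls of the subset are balls of the \<open>p\<close>-adic integers, of a level shifted by \<open>c\<close>, so
  equality of masses is inherited and survives normalization. Nonemptiness gives the set
  positive measure, so that the normalizing factor is finite.\<close>

lemma homogeneous_Haar_restricted:
  assumes S: "S \<subseteq> Zp p" "S \<noteq> {}" and sat: "\<And>x. x \<in> S \<Longrightarrow> Z.cell c x \<subseteq> S"
  shows "ball_tree.homogeneous (subtopology (padic_topology p) S) (\<lambda>k. near (k + c)) (Haar_restricted p S)"
proof -
  let ?H = "Haar_Zp p" and ?X = "subtopology (padic_topology p) S"
  interpret L: ball_tree ?X "\<lambda>k. near (k + c)" by (rule ball_tree_subspace(1)[OF S(1)])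
  have top: "topspace ?X = S" by (rule ball_tree_subspace(2)[OF S(1)])
  interpret H: prob_space ?H using homogeneous_Haar by (simp add: Z.homogeneous_def)
  have sH: "sets ?H = sets (borel_of Zp_top)" using homogeneous_Haar by (simp add: Z.homogeneous_def)
  have sp: "space ?H = Zp p" using sets_eq_imp_space_eq[OF sH] Z.space_borel_of by simp
  have "openin Zp_top S"
    unfolding Z.openin_iff using S sat by (auto simp: Z.cell_def intro!: exI[of _ c])
  then have SH: "S \<in> sets ?H" unfolding sH Z.sets_borel_of by (auto intro: sigma_sets.Basic)
  have cells: "L.cell k x = Z.cell (k + c) x" if "x \<in> S" for k x
  proof -
    have "near (k + c) x y \<Longrightarrow> near c x y" for y using near_mono[of c "k + c"] by simp
    then show ?thesis
      using sat[OF that] S(1) unfolding L.cell_def Z.cell_def top by auto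
  qed
  obtain s where s: "s \<in> S" using S(2) by blast
  have pos: "emeasure ?H S \<noteq> 0"
  proof -
    have "0 < measure ?H (Z.cell c s)"
      using s S(1) by (intro Z.homogeneous_cell_pos[OF homogeneous_Haar]) auto
    also have "\<dots> \<le> measure ?H S" using sat[OF s] SH by (rule H.finite_measure_mono)
    finally show ?thesis by (simp add: H.emeasure_eq_measure)
  qed
  have fin: "emeasure ?H S < \<top>" using H.emeasure_finite less_top by blast
  have sets_eq: "sets (Haar_restricted p S) = sets (borel_of ?X)"
  proof -
    have "sets (Haar_restricted p S) = (\<inter>) S ` sigma_sets (Zp p) {U. openin Zp_top U}"
      by (simp add: Haar_restricted_def sets_restrict_space sH Z.sets_borel_of)
    also have "\<dots> = sigma_sets S ((\<inter>) S ` {U. openin Zp_top U})"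
      using SH S(1) by (intro sigma_sets_Int) (simp_all add: sH Z.sets_borel_of)
    also have "(\<inter>) S ` {U. openin Zp_top U} = {U. openin (subtopology Zp_top S) U}"
      by (auto simp: openin_subtopology[of Zp_top S])
    also have "subtopology Zp_top S = ?X"
      using S(1) by (simp add: subtopology_subtopology Int_absorb1)
    also have "sigma_sets S {U. openin ?X U} = sets (borel_of ?X)"
      by (simp only: L.sets_borel_of top)
    finally show ?thesis .
  qed
  have em: "emeasure (Haar_restricted p S) A = inverse (emeasure ?H S) * emeasure ?H A" if "A \<subseteq> S" for A
    unfolding Haar_restricted_def using that SH
    by (simp add: emeasure_restrict_space)
  show ?thesis
    unfolding L.homogeneous_def
  proof (intro conjI allI ballI)
    show "prob_space (Haar_restricted p S)"
    proof (rule prob_spaceI)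
      have "space (Haar_restricted p S) = S"
        using sets_eq_imp_space_eq[OF sets_eq] L.space_borel_of top by simp
      then show "emeasure (Haar_restricted p S) (space (Haar_restricted p S)) = 1"
        using em[of S] ennreal_divide_self[OF pos] fin by (simp add: divide_ennreal_def mult.commute)
    qed
    fix k x y assume "x \<in> topspace ?X" "y \<in> topspace ?X"
    then have xy: "x \<in> S" "y \<in> S" using top by auto
    then have "measure ?H (Z.cell (k + c) x) = measure ?H (Z.cell (k + c) y)"
      using homogeneous_Haar S(1)
      unfolding Z.homogeneous_def topspace_subtopology topspace_padic carrier_Int_Zp by blast
    then have "emeasure ?H (Z.cell (k + c) x) = emeasure ?H (Z.cell (k + c) y)"
      by (simp add: H.emeasure_eq_measure)
    then have "emeasure (Haar_restricted p S) (L.cell k x) = emeasure (Haar_restricted p S) (L.cell k y)"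
      unfolding em[OF L.cell_subset[unfolded top]] unfolding cells[OF xy(1)] cells[OF xy(2)]
      by simp
    then show "measure (Haar_restricted p S) (L.cell k x) = measure (Haar_restricted p S) (L.cell k y)"
      by (simp add: measure_def)
  qed (rule sets_eq)
qed

section \<open>The power map on a sphere around 1\<close>

text \<open>Near 1, representatives eventually satisfy the hypotheses of \<open>v_power_diff\<close>.\<close>

lemma monomial_map_isometry:
  assumes x: "x \<in> carrier (Qp p)" "d x \<one>\<^bsub>Qp p\<^esub> < 1" and y: "y \<in> carrier (Qp p)" "d y \<one>\<^bsub>Qp p\<^esub> < 1"
    and n: "gcd n p = 1"
  shows "d (monomial_map p n x) (monomial_map p n y) = d x y"
proof -
  obtain X Y where *: "X \<in> padic_Cauchy p" "x = cls X" "Y \<in> padic_Cauchy p" "y = cls Y"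
    using x(1) y(1) by (auto elim!: carrierE)
  have "eventually (\<lambda>i. v (X i - 1) < 1) sequentially" "eventually (\<lambda>i. v (Y i - 1) < 1) sequentially"
    using x y * by (auto intro!: cls_d_less simp: cls_one)
  then have "eventually (\<lambda>i. v (X i ^ n - Y i ^ n) = v (X i - Y i)) sequentially"
    by eventually_elim (rule v_power_diff[OF _ _ n])
  then show ?thesis
    using * by (auto simp: monomial_map_def cls_pow intro!: d_eqI)
qed

lemma monomial_map_carrier: "x \<in> carrier (Qp p) \<Longrightarrow> monomial_map p n x \<in> carrier (Qp p)"
  by (auto elim!: carrierE simp: monomial_map_def cls_pow)

lemma monomial_map_one: "monomial_map p n \<one>\<^bsub>Qp p\<^esub> = \<one>\<^bsub>Qp p\<^esub>"
  by (simp add: monomial_map_def cls_pow cls_one)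

lemma one_carrier: "\<one>\<^bsub>Qp p\<^esub> \<in> carrier (Qp p)"
  by (simp add: cls_one)

lemma sphere_iff: "x \<in> sphere_at_one p l \<longleftrightarrow> x \<in> carrier (Qp p) \<and> d x \<one>\<^bsub>Qp p\<^esub> = P powi (- int l)"
  by (auto simp: sphere_at_one_def padic_sphere_def padic_dist_def one_carrier)

lemma powi_less_1: "l \<ge> 1 \<Longrightarrow> P powi (- int l) < 1"
  using power_int_strict_increasing[of "- int l" 0 P] P_gt_1 by simp

lemma sphere_Zp:
  assumes "l \<ge> 1"
  shows "sphere_at_one p l \<subseteq> Zp p"
proof
  fix x assume x: "x \<in> sphere_at_one p l"
  have "\<one>\<^bsub>Qp p\<^esub> \<in> Zp p" unfolding cls_one by (rule cls_Zp) simp_all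
  then show "x \<in> Zp p"
    using d_ultra[of x "\<one>\<^bsub>Qp p\<^esub>" "\<zero>\<^bsub>Qp p\<^esub>"] x powi_less_1[OF assms]
    by (auto simp: sphere_iff Zp_iff cls_zero)
qed

text \<open>The witness is \<open>1 + p ^ l\<close>.\<close>

lemma sphere_nonempty: "sphere_at_one p l \<noteq> {}"
proof -
  have "d (of_nat_Qp (1 + p ^ l)) \<one>\<^bsub>Qp p\<^esub> = v (of_int (int p ^ l))"
    using d_of_int[of "1 + int p ^ l" 1] by (simp add: of_nat_Qp_def cls_one)
  also have "\<dots> = P powi (- int l)"
    using prime_int prime by (subst v_of_int) (auto simp: multiplicity_same_power)
  finally have "of_nat_Qp (1 + p ^ l) \<in> sphere_at_one p l" by (simp add: sphere_iff)
  then show ?thesis by blast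
qed

text \<open>The two longest sides of an ultrametric triangle are equal: moving a point of
  the sphere by less than the radius of the sphere keeps it there.\<close>

lemma sphere_saturated:
  assumes "x \<in> sphere_at_one p l"
  shows "Z.cell (l + 1) x \<subseteq> sphere_at_one p l"
proof
  fix y assume "y \<in> Z.cell (l + 1) x"
  then have y: "y \<in> carrier (Qp p)" and xy: "d x y \<le> P powi (- int (l + 1))"
    using Zp_carrier by (auto simp: Z.cell_def near_def)
  have "P powi (- int (l + 1)) < P powi (- int l)"
    using P_gt_1 by (intro power_int_strict_increasing) auto
  then have lt: "d x y < P powi (- int l)" using xy by linarith
  have "d y \<one>\<^bsub>Qp p\<^esub> = P powi (- int l)"
    using d_ultra[of y x "\<one>\<^bsub>Qp p\<^esub>"] d_ultra[of x y "\<one>\<^bsub>Qp p\<^esub>"] assms y lt one_carrier d_commute[of x y]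
    by (auto simp: sphere_iff max_def split: if_splits)
  then show "y \<in> sphere_at_one p l" using y by (simp add: sphere_iff)
qed

end

theorem theorem4p2:
  fixes p l n :: nat
  assumes "prime p" and "l \<ge> 1" and "gcd n p = 1"
  shows "ergodic (Haar_restricted p (sphere_at_one p l)) (monomial_map p n) \<longleftrightarrow>
         uniquely_ergodic (subtopology (padic_topology p) (sphere_at_one p l)) (monomial_map p n)"
proof -
  interpret padic p by unfold_locales (rule assms(1))
  let ?S = "sphere_at_one p l"
  have SZ: "?S \<subseteq> Zp p" by (rule sphere_Zp[OF assms(2)])
  have top: "topspace (subtopology (padic_topology p) ?S) = ?S" by (rule ball_tree_subspace(2)[OF SZ])
  interpret L: ball_tree "subtopology (padic_topology p) ?S" "\<lambda>k. near (k + (l + 1))"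
    by (rule ball_tree_subspace(1)[OF SZ])
  have small: "x \<in> carrier (Qp p)" "d x \<one>\<^bsub>Qp p\<^esub> < 1" if "x \<in> ?S" for x
    using that powi_less_1[OF assms(2)] by (auto simp: sphere_iff)
  have "L.level_isometry (monomial_map p n)"
    unfolding L.level_isometry_def top
  proof (intro conjI funcsetI allI ballI)
    fix x assume x: "x \<in> ?S"
    have "d (monomial_map p n x) (monomial_map p n \<one>\<^bsub>Qp p\<^esub>) = d x \<one>\<^bsub>Qp p\<^esub>"
      using small[OF x] one_carrier by (intro monomial_map_isometry assms(3)) auto
    then show "monomial_map p n x \<in> ?S"
      using x monomial_map_carrier by (simp add: sphere_iff monomial_map_one)
  next
    fix k x y assume "x \<in> ?S" "y \<in> ?S"
    then show "near (k + (l + 1)) (monomial_map p n x) (monomial_map p n y) \<longleftrightarrow> near (k + (l + 1)) x y"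
      using small assms(3) by (simp add: near_def monomial_map_isometry)
  qed
  moreover have "L.homogeneous (Haar_restricted p ?S)"
    by (rule homogeneous_Haar_restricted[OF SZ sphere_nonempty sphere_saturated])
  ultimately show ?thesis by (rule L.ergodic_iff_uniquely_ergodic)
qed

end
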